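(* Let $(M,g)$ be a connected $n$-dimensional Riemannian manifold and let its tangent bundle $TM$ be equipped with the metric $\tilde g = a g_1 + b g_2 + c g_3$, where $a,b,c$ are positive real numbers with $ac-b^2\neq 0$. Then every inessential fiber-preserving conformal vector field on $(TM,\tilde g)$ is homothetic.
   Context: Manifolds, metrics, vector fields and functions are smooth. Let $\pi:TM\to M$ be the projection, $(x^i)$ local coordinates on $M$, $(x^i,y^i)$ the induced coordinates on $TM$, $g_{ij}$ the components of $g$, and $\Gamma_{j\ i}^{\ k}$ the coefficients (Christoffel symbols) of the Riemannian (Levi-Civita) connection of $g$. Summation over repeated indices is understood. Adapted frame on $TM$: $X_h = \frac{\partial}{\partial x^h} - y^a\Gamma_{a\ h}^{\ m}\frac{\partial}{\partial y^m}$ and $X_{\bar h} = \frac{\partial}{\partial y^h}$. Its dual basis is $\{dx^h,\delta y^h\}$ with $\delta y^h = dy^h + y^a\Gamma_{a\ i}^{\ h}dx^i$. Globally defined symmetric bilinear forms on $TM$: $g_1 = g_{ij}dx^i dx^j$, $g_2 = 2g_{ij}dx^i\delta y^j$, $g_3 = g_{ij}\delta y^i\delta y^j$. Thus $\tilde g = a g_1+b g_2+c g_3$ is given by $\tilde g(X_i,X_j)=a g_{ij}$, $\tilde g(X_i,X_{\bar j}) = b g_{ij}$, $\tilde g(X_{\bar i},X_{\bar j}) = c g_{ij}$. When $ac-b^2\ne 0$ this is a nondegenerate (Riemannian or pseudo-Riemannian) metric on $TM$. A vector field $X$ on $TM$ is fiber-preserving if each local transformation of the local one-parameter group it generates maps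 fibers of $TM$ to fibers; equivalently, writing $X = X^hX_h+X^{\bar h}X_{\bar h}$, the components $X^h$ are functions on $M$ (depend only on $(x^i)$). A vector field $X$ on $TM$ is conformal (with respect to $\tilde g$) if there is a scalar function $\Omega$ on $TM$ with $\mathcal{L}_X\tilde g = 2\Omega\tilde g$, where $\mathcal{L}_X$ is the Lie derivative. A conformal vector field is inessential if $\Omega$ depends only on $(x^h)$, i.e. $\Omega$ is (the pullback by $\pi$ of) a function on $M$; it is homothetic if $\Omega$ is constant. *)

theory Defs
  imports "HOL-Analysis.Analysis"
begin

primrec Ck_on :: "nat \<Rightarrow> 'a::euclidean_space set \<Rightarrow> ('a \<Rightarrow> 'b::euclidean_space) \<Rightarrow> bool" where
  "Ck_on 0 S f \<longleftrightarrow> continuous_on S f"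
| "Ck_on (Suc k) S f \<longleftrightarrow>
     (\<forall>x\<in>S. f differentiable (at x)) \<and> (\<forall>v. Ck_on k S (\<lambda>x. frechet_derivative f (at x) v))"

definition smooth_on :: "'a::euclidean_space set \<Rightarrow> ('a \<Rightarrow> 'b::euclidean_space) \<Rightarrow> bool" where
  "smooth_on S f \<longleftrightarrow> (\<forall>k. Ck_on k S f)"

text \<open>A chart is a pair of its domain and its coordinate map; the values of the coordinate map
  outside the domain are irrelevant. Atlases are not required to be maximal.\<close>

type_synonym ('m, 'e) chart = "'m set \<times> ('m \<Rightarrow> 'e)"

abbreviation chart_dom :: "('m, 'e) chart \<Rightarrow> 'm set" where
  "chart_dom c \<equiv> fst c"

abbreviation chart_img :: "('m, 'e) chart \<Rightarrow> 'e set" where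
  "chart_img c \<equiv> snd c ` fst c"

definition chart_inv :: "('m, 'e) chart \<Rightarrow> 'e \<Rightarrow> 'm" where
  "chart_inv c = inv_into (chart_dom c) (snd c)"

definition transition :: "('m, 'e) chart \<Rightarrow> ('m, 'e) chart \<Rightarrow> 'e \<Rightarrow> 'e" where
  "transition c d = snd d \<circ> chart_inv c"

definition carrier_of :: "('m, 'e) chart set \<Rightarrow> 'm set" where
  "carrier_of A = (\<Union>c\<in>A. chart_dom c)"

definition smooth_manifold :: "'m topology \<Rightarrow> ('m, 'e::euclidean_space) chart set \<Rightarrow> bool" where
  "smooth_manifold M A \<longleftrightarrow>
     Hausdorff_space M \<and> second_countable M \<and> carrier_of A = topspace M \<and>
     (\<forall>c\<in>A. openin M (chart_dom c) \<and> open (chart_img c) \<and>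
        homeomorphic_map (subtopology M (chart_dom c)) (top_of_set (chart_img c)) (snd c)) \<and>
     (\<forall>c\<in>A. \<forall>d\<in>A. smooth_on (snd c ` (chart_dom c \<inter> chart_dom d)) (transition c d))"

text \<open>A tangent vector at \<open>p\<close> is the family of its components in all charts around \<open>p\<close>, related by
  the Jacobians of the chart changes. The value 0 at all other charts makes the family unique.\<close>

type_synonym ('m, 'e) tvec = "('m, 'e) chart \<Rightarrow> 'e"

definition tangent_space ::
  "('m, 'e::euclidean_space) chart set \<Rightarrow> 'm \<Rightarrow> ('m, 'e) tvec set" where
  "tangent_space A p =
     {w. (\<forall>c. \<not> (c \<in> A \<and> p \<in> chart_dom c) \<longrightarrow> w c = 0) \<and>
         (\<forall>c\<in>A. \<forall>d\<in>A. p \<in> chart_dom c \<inter> chart_dom d \<longrightarrow>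
            w d = frechet_derivative (transition c d) (at (snd c p)) (w c))}"

definition tangent_of ::
  "('m, 'e::euclidean_space) chart set \<Rightarrow> ('m, 'e) chart \<Rightarrow> 'm \<Rightarrow> 'e \<Rightarrow> ('m, 'e) tvec" where
  "tangent_of A c p u = (\<lambda>d. if d \<in> A \<and> p \<in> chart_dom d
     then frechet_derivative (transition c d) (at (snd c p)) u else 0)"

definition smooth_function ::
  "('m, 'e::euclidean_space) chart set \<Rightarrow> ('m \<Rightarrow> real) \<Rightarrow> bool" where
  "smooth_function A f \<longleftrightarrow> (\<forall>c\<in>A. smooth_on (chart_img c) (f \<circ> chart_inv c))"

definition vf_in :: "('m, 'e) chart \<Rightarrow> ('m \<Rightarrow> ('m, 'e) tvec) \<Rightarrow> 'e \<Rightarrow> 'e" where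
  "vf_in c X x = X (chart_inv c x) c"

definition vector_field ::
  "('m, 'e::euclidean_space) chart set \<Rightarrow> ('m \<Rightarrow> ('m, 'e) tvec) \<Rightarrow> bool" where
  "vector_field A X \<longleftrightarrow>
     (\<forall>p\<in>carrier_of A. X p \<in> tangent_space A p) \<and>
     (\<forall>c\<in>A. smooth_on (chart_img c) (vf_in c X))"

type_synonym ('m, 'e) tensor2 = "'m \<Rightarrow> ('m, 'e) tvec \<Rightarrow> ('m, 'e) tvec \<Rightarrow> real"

definition tensor_in ::
  "('m, 'e::euclidean_space) chart set \<Rightarrow> ('m, 'e) chart \<Rightarrow> ('m, 'e) tensor2 \<Rightarrow>
   'e \<Rightarrow> 'e \<Rightarrow> 'e \<Rightarrow> real" where
  "tensor_in A c g x u v =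
     g (chart_inv c x) (tangent_of A c (chart_inv c x) u) (tangent_of A c (chart_inv c x) v)"

definition riemannian_metric ::
  "('m, 'e::euclidean_space) chart set \<Rightarrow> ('m, 'e) tensor2 \<Rightarrow> bool" where
  "riemannian_metric A g \<longleftrightarrow>
     (\<forall>c\<in>A.
        (\<forall>x\<in>chart_img c. bilinear (tensor_in A c g x) \<and>
           (\<forall>u v. tensor_in A c g x u v = tensor_in A c g x v u) \<and>
           (\<forall>u. u \<noteq> 0 \<longrightarrow> tensor_in A c g x u u > 0)) \<and>
        (\<forall>u v. smooth_on (chart_img c) (\<lambda>x. tensor_in A c g x u v)))"

text \<open>The chart expression
  \<open>X\<^sup>k \<partial>\<^sub>k G\<^sub>i\<^sub>j + G\<^sub>k\<^sub>j \<partial>\<^sub>i X\<^sup>k + G\<^sub>i\<^sub>k \<partial>\<^sub>j X\<^sup>k\<close>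
  of the Lie derivative of \<open>G\<close> along \<open>X\<close>, evaluated on two tangent vectors at \<open>p\<close>.\<close>

definition lie_derivative ::
  "('m, 'e::euclidean_space) chart set \<Rightarrow> ('m, 'e) chart \<Rightarrow> ('m \<Rightarrow> ('m, 'e) tvec) \<Rightarrow>
   ('m, 'e) tensor2 \<Rightarrow> ('m, 'e) tensor2" where
  "lie_derivative A c X G p \<xi> \<eta> =
     (let x = snd c p; DX = frechet_derivative (vf_in c X) (at x) in
        frechet_derivative (\<lambda>z. tensor_in A c G z (\<xi> c) (\<eta> c)) (at x) (vf_in c X x)
        + tensor_in A c G x (DX (\<xi> c)) (\<eta> c)
        + tensor_in A c G x (\<xi> c) (DX (\<eta> c)))"

definition conformal_with ::
  "('m, 'e::euclidean_space) chart set \<Rightarrow> ('m, 'e) tensor2 \<Rightarrow> ('m \<Rightarrow> ('m, 'e) tvec) \<Rightarrow>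
   ('m \<Rightarrow> real) \<Rightarrow> bool" where
  "conformal_with A G X \<Omega> \<longleftrightarrow>
     vector_field A X \<and> smooth_function A \<Omega> \<and>
     (\<forall>c\<in>A. \<forall>p\<in>chart_dom c. \<forall>\<xi>\<in>tangent_space A p. \<forall>\<eta>\<in>tangent_space A p.
        lie_derivative A c X G p \<xi> \<eta> = 2 * \<Omega> p * G p \<xi> \<eta>)"

definition homothetic ::
  "('m, 'e::euclidean_space) chart set \<Rightarrow> ('m, 'e) tensor2 \<Rightarrow> ('m \<Rightarrow> ('m, 'e) tvec) \<Rightarrow> bool" where
  "homothetic A G X \<longleftrightarrow>
     (\<exists>\<Omega>. conformal_with A G X \<Omega> \<and> (\<exists>k. \<forall>p\<in>carrier_of A. \<Omega> p = k))"

definition tangent_bundle ::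
  "('m, 'e::euclidean_space) chart set \<Rightarrow> ('m \<times> ('m, 'e) tvec) set" where
  "tangent_bundle A = Sigma (carrier_of A) (tangent_space A)"

definition induced_chart ::
  "('m, 'e::euclidean_space) chart set \<Rightarrow> ('m, 'e) chart \<Rightarrow>
   ('m \<times> ('m, 'e) tvec, 'e \<times> 'e) chart" where
  "induced_chart A c =
     ({q \<in> tangent_bundle A. fst q \<in> chart_dom c}, \<lambda>q. (snd c (fst q), snd q c))"

definition tangent_atlas ::
  "('m, 'e::euclidean_space) chart set \<Rightarrow> ('m \<times> ('m, 'e) tvec, 'e \<times> 'e) chart set" where
  "tangent_atlas A = induced_chart A ` A"

definition gmat ::
  "('m, real^'n) chart set \<Rightarrow> ('m, real^'n) chart \<Rightarrow> ('m, real^'n) tensor2 \<Rightarrow>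
   real^'n \<Rightarrow> real^'n^'n" where
  "gmat A c g x = (\<chi> i j. tensor_in A c g x (axis i 1) (axis j 1))"

definition dgmat ::
  "('m, real^'n) chart set \<Rightarrow> ('m, real^'n) chart \<Rightarrow> ('m, real^'n) tensor2 \<Rightarrow>
   real^'n \<Rightarrow> 'n \<Rightarrow> 'n \<Rightarrow> 'n \<Rightarrow> real" where
  "dgmat A c g x l i j = frechet_derivative (\<lambda>z. gmat A c g z $ i $ j) (at x) (axis l 1)"

text \<open>\<open>christoffel A c g x k i j\<close> is the coefficient with upper index \<open>k\<close> and lower indices
  \<open>i\<close>, \<open>j\<close>.\<close>

definition christoffel ::
  "('m, real^'n) chart set \<Rightarrow> ('m, real^'n) chart \<Rightarrow> ('m, real^'n) tensor2 \<Rightarrow>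
   real^'n \<Rightarrow> 'n \<Rightarrow> 'n \<Rightarrow> 'n \<Rightarrow> real" where
  "christoffel A c g x k i j =
     (\<Sum>l\<in>UNIV. matrix_inv (gmat A c g x) $ k $ l *
        (dgmat A c g x i j l + dgmat A c g x j i l - dgmat A c g x l i j)) / 2"

text \<open>For a tangent vector \<open>\<xi>\<close> to \<open>TM\<close> at a point \<open>q\<close> over \<open>p\<close>, both the family
  \<open>dx\<^sup>h(\<xi>)\<close> (that is, the image of \<open>\<xi>\<close> under the differential of the projection) and the
  family \<open>\<delta>y\<^sup>h(\<xi>)\<close> are the components of tangent vectors to \<open>M\<close> at \<open>p\<close>.\<close>

definition hor_part ::
  "('m, real^'n) chart set \<Rightarrow> 'm \<times> ('m, real^'n) tvec \<Rightarrow>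
   ('m \<times> ('m, real^'n) tvec, (real^'n) \<times> (real^'n)) tvec \<Rightarrow> ('m, real^'n) tvec" where
  "hor_part A q \<xi> = (\<lambda>c. if c \<in> A \<and> fst q \<in> chart_dom c
     then fst (\<xi> (induced_chart A c)) else 0)"

definition ver_part ::
  "('m, real^'n) chart set \<Rightarrow> ('m, real^'n) tensor2 \<Rightarrow> 'm \<times> ('m, real^'n) tvec \<Rightarrow>
   ('m \<times> ('m, real^'n) tvec, (real^'n) \<times> (real^'n)) tvec \<Rightarrow> ('m, real^'n) tvec" where
  "ver_part A g q \<xi> = (\<lambda>c. if c \<in> A \<and> fst q \<in> chart_dom c
     then \<chi> h. snd (\<xi> (induced_chart A c)) $ h
       + (\<Sum>j\<in>UNIV. \<Sum>i\<in>UNIV. snd q c $ j * christoffel A c g (snd c (fst q)) h j i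
            * fst (\<xi> (induced_chart A c)) $ i)
     else 0)"

definition lift_metric1 where
  "lift_metric1 A g q \<xi> \<eta> = g (fst q) (hor_part A q \<xi>) (hor_part A q \<eta>)"

text \<open>The symmetric product \<open>2 g\<^sub>i\<^sub>j dx\<^sup>i \<delta>y\<^sup>j\<close> takes the value \<open>g\<^sub>i\<^sub>j\<close> on the
  \<open>i\<close>-th horizontal and the \<open>j\<close>-th vertical vector of the adapted frame.\<close>

definition lift_metric2 where
  "lift_metric2 A g q \<xi> \<eta> =
     g (fst q) (hor_part A q \<xi>) (ver_part A g q \<eta>) + g (fst q) (ver_part A g q \<xi>) (hor_part A q \<eta>)"

definition lift_metric3 where
  "lift_metric3 A g q \<xi> \<eta> = g (fst q) (ver_part A g q \<xi>) (ver_part A g q \<eta>)"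

definition lift_metric ::
  "('m, real^'n) chart set \<Rightarrow> ('m, real^'n) tensor2 \<Rightarrow> real \<Rightarrow> real \<Rightarrow> real \<Rightarrow>
   ('m \<times> ('m, real^'n) tvec, (real^'n) \<times> (real^'n)) tensor2" where
  "lift_metric A g a b c q \<xi> \<eta> =
     a * lift_metric1 A g q \<xi> \<eta> + b * lift_metric2 A g q \<xi> \<eta> + c * lift_metric3 A g q \<xi> \<eta>"

text \<open>The clause with \<open>eventually\<close> says that the curve is continuous, so that the chart expression
  of the curve is meaningful near the parameter at which it is differentiated.\<close>

definition integral_curve ::
  "('m, 'e::euclidean_space) chart set \<Rightarrow> ('m \<Rightarrow> ('m, 'e) tvec) \<Rightarrow> real set \<Rightarrow>
   (real \<Rightarrow> 'm) \<Rightarrow> bool" where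
  "integral_curve A X J \<gamma> \<longleftrightarrow>
     (\<forall>s\<in>J. \<gamma> s \<in> carrier_of A \<and>
        (\<forall>c\<in>A. \<gamma> s \<in> chart_dom c \<longrightarrow>
           eventually (\<lambda>r. \<gamma> r \<in> chart_dom c) (at s within J) \<and>
           ((\<lambda>r. snd c (\<gamma> r)) has_vector_derivative X (\<gamma> s) c) (at s within J)))"

text \<open>\<open>flow_rel A X t\<close> is the graph of the time-\<open>t\<close> transformation of the local one-parameter
  group generated by \<open>X\<close>, on its maximal domain.\<close>

definition flow_rel ::
  "('m, 'e::euclidean_space) chart set \<Rightarrow> ('m \<Rightarrow> ('m, 'e) tvec) \<Rightarrow> real \<Rightarrow> 'm \<Rightarrow> 'm \<Rightarrow> bool" where
  "flow_rel A X t q r \<longleftrightarrow>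
     (\<exists>\<gamma>. integral_curve A X (closed_segment 0 t) \<gamma> \<and> \<gamma> 0 = q \<and> \<gamma> t = r)"

definition fiber_preserving ::
  "('m, 'e::euclidean_space) chart set \<Rightarrow>
   ('m \<times> ('m, 'e) tvec \<Rightarrow> ('m \<times> ('m, 'e) tvec, 'e \<times> 'e) tvec) \<Rightarrow> bool" where
  "fiber_preserving A X \<longleftrightarrow>
     (\<forall>t q\<^sub>1 q\<^sub>2 r\<^sub>1 r\<^sub>2.
        flow_rel (tangent_atlas A) X t q\<^sub>1 r\<^sub>1 \<and> flow_rel (tangent_atlas A) X t q\<^sub>2 r\<^sub>2 \<and>
        fst q\<^sub>1 = fst q\<^sub>2 \<longrightarrow> fst r\<^sub>1 = fst r\<^sub>2)"

definition inessential_conformal ::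
  "('m, 'e::euclidean_space) chart set \<Rightarrow>
   ('m \<times> ('m, 'e) tvec, 'e \<times> 'e) tensor2 \<Rightarrow>
   ('m \<times> ('m, 'e) tvec \<Rightarrow> ('m \<times> ('m, 'e) tvec, 'e \<times> 'e) tvec) \<Rightarrow> bool" where
  "inessential_conformal A G X \<longleftrightarrow>
     (\<exists>\<Omega>. conformal_with (tangent_atlas A) G X \<Omega> \<and>
        (\<exists>f. \<forall>q\<in>tangent_bundle A. \<Omega> q = f (fst q)))"

end

theory Submission
  imports Defs
begin

text \<open>
  In an induced chart write the field as \<open>X(x, y) = (X(x), V(x, y))\<close>; that the first component
  does not depend on \<open>y\<close> follows by differentiating, at time 0, integral curves starting in one
  fiber. Let \<open>H(y, u, v) = g(\<Gamma>(y, u), v)\<close> be the Christoffel form of the first kind.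

  The vertical-vertical part of the conformal equation says that the symmetrized \<open>y\<close>-derivative of
  \<open>V(x, \<cdot>)\<close> does not depend on \<open>y\<close>, hence \<open>V(x, y) = V(x, 0) + h\<^sub>x(y)\<close> with \<open>h\<^sub>x\<close> linear. The
  \<open>y\<close>-linear part of the horizontal-vertical equation then determines \<open>g((\<partial>\<^sub>u h)(y), v)\<close> in terms
  of \<open>H\<close>. Differentiating the vertical-vertical equation in the direction \<open>u\<close> and inserting this,
  together with \<open>\<partial>\<^sub>u g(y, v) = H(y, u, v) + H(v, u, y)\<close> and the symmetry of second derivatives,
  everything cancels except \<open>2 (\<partial>\<^sub>u \<Omega>) g(y, v)\<close>. So \<open>\<Omega>\<close> is locally constant, and constant since
  \<open>M\<close> is connected.
\<close>

section \<open>Differential calculus\<close>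

abbreviation D :: "('a::real_normed_vector \<Rightarrow> 'b::real_normed_vector) \<Rightarrow> 'a \<Rightarrow> 'a \<Rightarrow> 'b" where
  "D f x \<equiv> frechet_derivative f (at x)"

lemma D_eqI: "(f has_derivative f') (at x) \<Longrightarrow> D f x = f'"
  by (rule frechet_derivative_at[symmetric])

lemma D_works: "f differentiable (at x) \<Longrightarrow> (f has_derivative D f x) (at x)"
  by (simp add: frechet_derivative_works)

lemma linear_D: "f differentiable (at x) \<Longrightarrow> linear (D f x)"
  by (rule linear_frechet_derivative)

text \<open>\<open>frechet_derivative\<close> is a choice among the derivatives at x. Functions
  agreeing near x have the same set of derivatives there, so the choices coincide even at points
  where this set is empty.\<close>

lemma D_cong:
  assumes "open S" "x \<in> S" "\<And>z. z \<in> S \<Longrightarrow> f z = h z"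
  shows "D f x = D h x"
proof -
  have "(f has_derivative f') (at x) \<longleftrightarrow> (h has_derivative f') (at x)" for f'
    using has_derivative_transform_within_open[of f f' x UNIV S h]
      has_derivative_transform_within_open[of h f' x UNIV S f] assms by auto
  then show ?thesis by (simp add: frechet_derivative_def)
qed

lemma smooth_on_differentiable: "smooth_on S f \<Longrightarrow> x \<in> S \<Longrightarrow> f differentiable (at x)"
  unfolding smooth_on_def by (metis Ck_on.simps(2))

lemma smooth_on_D: "smooth_on S f \<Longrightarrow> smooth_on S (\<lambda>x. D f x v)"
  unfolding smooth_on_def by (metis Ck_on.simps(2))

lemma smooth_on_continuous: "smooth_on S f \<Longrightarrow> continuous_on S f"
  unfolding smooth_on_def by (metis Ck_on.simps(1))

section \<open>Symmetry of second derivatives\<close>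

lemma has_real_derivative_along_line:
  assumes "f differentiable (at (p + s *\<^sub>R u))"
  shows "((\<lambda>s. f (p + s *\<^sub>R u)) has_real_derivative D f (p + s *\<^sub>R u) u) (at s)"
proof -
  have "((\<lambda>s. p + s *\<^sub>R u) has_derivative (\<lambda>h. h *\<^sub>R u)) (at s)"
    by (auto intro!: derivative_eq_intros)
  from diff_chain_at[OF this] D_works[OF assms]
  have "((\<lambda>s. f (p + s *\<^sub>R u)) has_derivative (\<lambda>h. D f (p + s *\<^sub>R u) (h *\<^sub>R u))) (at s)"
    by (auto simp: o_def)
  moreover have "D f (p + s *\<^sub>R u) (h *\<^sub>R u) = D f (p + s *\<^sub>R u) u * h" for h
    using linear_cmul[OF linear_D[OF assms]] by simp
  ultimately show ?thesis by (simp add: has_field_derivative_def)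
qed

text \<open>The mean value theorem is used twice: in direction u for the difference of f along two
  parallel segments, then in direction v for \<open>D f _ u\<close>. The second difference is
  symmetric in u and v, which is what makes it useful.\<close>

lemma second_difference_mean_value:
  fixes f :: "'a::real_normed_vector \<Rightarrow> real"
  assumes h: "h > 0" "h * (norm u + norm v) < r"
    and f: "\<And>z. z \<in> ball x r \<Longrightarrow> f differentiable (at z)"
    and f': "\<And>z. z \<in> ball x r \<Longrightarrow> (\<lambda>z. D f z u) differentiable (at z)"
  obtains z where "dist x z \<le> h * (norm u + norm v)"
    "f (x + h *\<^sub>R u + h *\<^sub>R v) - f (x + h *\<^sub>R u) - f (x + h *\<^sub>R v) + f x
       = h * h * D (\<lambda>z. D f z u) z v"
proof -
  have d: "dist x (x + s *\<^sub>R u + t *\<^sub>R v) \<le> h * (norm u + norm v)"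
    if "0 \<le> s" "s \<le> h" "0 \<le> t" "t \<le> h" for s t
  proof -
    have "norm (s *\<^sub>R u + t *\<^sub>R v) \<le> s * norm u + t * norm v"
      using norm_triangle_ineq[of "s *\<^sub>R u" "t *\<^sub>R v"] that by simp
    also have "\<dots> \<le> h * norm u + h * norm v"
      using that by (intro add_mono mult_right_mono) auto
    finally have "norm (s *\<^sub>R u + t *\<^sub>R v) \<le> h * (norm u + norm v)"
      by (simp only: distrib_left)
    moreover have "dist x (x + s *\<^sub>R u + t *\<^sub>R v) = norm (s *\<^sub>R u + t *\<^sub>R v)"
      using norm_minus_cancel[of "s *\<^sub>R u + t *\<^sub>R v"] by (simp add: dist_norm)
    ultimately show ?thesis by simp
  qed
  have b: "x + s *\<^sub>R u + t *\<^sub>R v \<in> ball x r" if "0 \<le> s" "s \<le> h" "0 \<le> t" "t \<le> h" for s t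
    using d[OF that] h by auto
  have "((\<lambda>s. f ((x + h *\<^sub>R v) + s *\<^sub>R u) - f (x + s *\<^sub>R u)) has_real_derivative
      D f ((x + h *\<^sub>R v) + s *\<^sub>R u) u - D f (x + s *\<^sub>R u) u) (at s)" if "0 \<le> s" "s \<le> h" for s
    using b[of s h] b[of s 0] h that
    by (intro DERIV_diff has_real_derivative_along_line f) (auto simp: algebra_simps)
  from MVT2[OF h(1) this] obtain s where s: "0 < s" "s < h" and
    1: "f (x + h *\<^sub>R v + h *\<^sub>R u) - f (x + h *\<^sub>R u) - (f (x + h *\<^sub>R v) - f x)
       = h * (D f (x + h *\<^sub>R v + s *\<^sub>R u) u - D f (x + s *\<^sub>R u) u)"
    by auto
  have "((\<lambda>t. D f (x + s *\<^sub>R u + t *\<^sub>R v) u) has_real_derivative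
      D (\<lambda>z. D f z u) (x + s *\<^sub>R u + t *\<^sub>R v) v) (at t)" if "0 \<le> t" "t \<le> h" for t
    using b[of s t] s that
    by (intro has_real_derivative_along_line[of "\<lambda>z. D f z u"] f') auto
  from MVT2[OF h(1) this] obtain t where t: "0 < t" "t < h" and
    2: "D f (x + s *\<^sub>R u + h *\<^sub>R v) u - D f (x + s *\<^sub>R u) u
       = h * D (\<lambda>z. D f z u) (x + s *\<^sub>R u + t *\<^sub>R v) v"
    by auto
  show thesis
    using d[of s t] s t 1 2
    by (intro that[of "x + s *\<^sub>R u + t *\<^sub>R v"]) (auto simp: algebra_simps)
qed

text \<open>The same second difference, computed in both orders, equates the two mixed derivatives
  at two points near x; continuity transfers this to x.\<close>

lemma D_commute_real:
  fixes f :: "'a::euclidean_space \<Rightarrow> real"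
  assumes "open S" "x \<in> S" "smooth_on S f"
  shows "D (\<lambda>z. D f z u) x v = D (\<lambda>z. D f z v) x u" (is "?a x = ?b x")
proof (rule ccontr)
  assume neq: "?a x \<noteq> ?b x"
  \<comment> \<open>Half the gap: a number within e of \<open>?a x\<close> and another within e of
    \<open>?b x\<close> cannot be equal.\<close>
  define e where "e = \<bar>?a x - ?b x\<bar> / 2"
  have e: "e > 0" using neq by (simp add: e_def)
  have "isCont ?a x" "isCont ?b x"
    using smooth_on_continuous[OF smooth_on_D[OF smooth_on_D[OF assms(3)]]] assms(1,2)
    by (simp_all add: continuous_on_eq_continuous_at)
  then obtain d1 d2 where d: "d1 > 0" "d2 > 0"
    "\<And>z. dist z x < d1 \<Longrightarrow> dist (?a z) (?a x) < e" "\<And>z. dist z x < d2 \<Longrightarrow> dist (?b z) (?b x) < e"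
    using e unfolding continuous_at_eps_delta by metis
  obtain r where r: "r > 0" "ball x r \<subseteq> S" using assms openE by blast
  define m where "m = min r (min d1 d2)"
  have m: "m > 0" using r d by (simp add: m_def)
  \<comment> \<open>The summand 1 keeps the denominator positive when u and v vanish and makes
    \<open>h * (norm u + norm v)\<close> strictly smaller than m.\<close>
  define h where "h = m / (norm u + norm v + 1)"
  have "norm u + norm v + 1 > 0" by (simp add: add_nonneg_pos)
  then have h0: "h > 0" and "h * (norm u + norm v + 1) = m"
    using m by (simp_all add: h_def)
  then have h: "h > 0" "h * (norm u + norm v) < m"
    by (simp_all add: distrib_left)
  then have hr: "h * (norm u + norm v) < r" "h * (norm v + norm u) < r"
    by (auto simp: m_def add.commute)
  have df: "f differentiable (at z)" "(\<lambda>z. D f z w) differentiable (at z)" if "z \<in> ball x r" for z w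
    using that r assms smooth_on_differentiable smooth_on_D by blast+
  obtain z1 where z1: "dist x z1 \<le> h * (norm u + norm v)"
    "f (x + h *\<^sub>R u + h *\<^sub>R v) - f (x + h *\<^sub>R u) - f (x + h *\<^sub>R v) + f x = h * h * ?a z1"
    using second_difference_mean_value[OF h(1) hr(1) df] by blast
  obtain z2 where z2: "dist x z2 \<le> h * (norm v + norm u)"
    "f (x + h *\<^sub>R v + h *\<^sub>R u) - f (x + h *\<^sub>R v) - f (x + h *\<^sub>R u) + f x = h * h * ?b z2"
    using second_difference_mean_value[OF h(1) hr(2) df] by blast
  have "h * h * ?a z1 = h * h * ?b z2"
    using z1(2) z2(2) by (simp add: algebra_simps)
  then have "?a z1 = ?b z2" using h by simp
  moreover have "dist (?a z1) (?a x) < e" "dist (?b z2) (?b x) < e"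
    using z1(1) z2(1) h(2)
    by (simp_all add: d(3,4) m_def dist_commute[of _ x] add.commute[of "norm v"])
  ultimately show False
    using dist_triangle2[of "?a x" "?b x" "?a z1"] dist_commute[of "?a z1" "?a x"]
      dist_commute[of "?b z2" "?b x"]
    by (simp add: e_def dist_real_def)
qed

lemma D_inner_left:
  assumes "f differentiable (at x)"
  shows "D (\<lambda>z. f z \<bullet> b) x u = D f x u \<bullet> b"
  using has_derivative_inner_left[OF D_works[OF assms], of b] by (simp add: D_eqI)

text \<open>The derivatives in \<open>Ck_on\<close> are taken in the full space, so openness of S is
  what lets the values on S determine them.\<close>

lemma Ck_on_cong:
  assumes "open S" "\<And>x. x \<in> S \<Longrightarrow> f x = h x" "Ck_on k S f"
  shows "Ck_on k S h"
  using assms(2,3)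
proof (induction k arbitrary: f h)
  case 0
  then show ?case by (auto cong: continuous_on_cong)
next
  case (Suc k)
  have "h differentiable (at x)" if "x \<in> S" for x
  proof -
    have "(f has_derivative D f x) (at x)" using Suc.prems(2) that by (simp add: D_works)
    from has_derivative_transform_within_open[OF this assms(1) that Suc.prems(1)]
    show ?thesis by (rule differentiableI)
  qed
  moreover have "Ck_on k S (\<lambda>x. D h x v)" for v
  proof (rule Suc.IH)
    show "D f x v = D h x v" if "x \<in> S" for x
      using D_cong[OF assms(1) that Suc.prems(1)] by simp
    show "Ck_on k S (\<lambda>x. D f x v)" using Suc.prems(2) by simp
  qed
  ultimately show ?case by simp
qed

lemma smooth_on_inner_left:
  fixes f :: "'a::euclidean_space \<Rightarrow> 'b::euclidean_space"
  assumes "open S" "smooth_on S f"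
  shows "smooth_on S (\<lambda>x. f x \<bullet> b)"
proof -
  have "Ck_on k S f \<Longrightarrow> Ck_on k S (\<lambda>x. f x \<bullet> b)" for k
  proof (induction k arbitrary: f)
    case 0
    then show ?case by (auto intro: continuous_intros)
  next
    case (Suc k)
    have "Ck_on k S (\<lambda>x. D (\<lambda>z. f z \<bullet> b) x v)" for v
      using Suc by (intro Ck_on_cong[OF assms(1) _ Suc.IH[of "\<lambda>x. D f x v"]]) (auto simp: D_inner_left)
    moreover have "(\<lambda>z. f z \<bullet> b) differentiable (at x)" if "x \<in> S" for x
      using Suc.prems that has_derivative_inner_left unfolding Ck_on.simps differentiable_def by blast
    ultimately show ?case by simp
  qed
  then show ?thesis using assms by (simp add: smooth_on_def)
qed

lemma D_commute:
  fixes f :: "'a::euclidean_space \<Rightarrow> 'b::euclidean_space"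
  assumes S: "open S" "x \<in> S" "smooth_on S f"
  shows "D (\<lambda>z. D f z u) x v = D (\<lambda>z. D f z v) x u"
proof (rule euclidean_eqI)
  fix b :: 'b
  \<comment> \<open>Taking a component commutes with both differentiations, which reduces the claim
    to real-valued functions.\<close>
  have "D (\<lambda>z. D f z u) x v \<bullet> b = D (\<lambda>z. D (\<lambda>z. f z \<bullet> b) z u) x v" for u v
  proof -
    have "D (\<lambda>z. D f z u) x v \<bullet> b = D (\<lambda>z. D f z u \<bullet> b) x v"
      using smooth_on_differentiable[OF smooth_on_D[OF S(3)] S(2)] by (rule D_inner_left[symmetric])
    also have "D (\<lambda>z. D f z u \<bullet> b) x = D (\<lambda>z. D (\<lambda>z. f z \<bullet> b) z u) x"
      by (rule D_cong[OF S(1,2)]) (simp add: D_inner_left smooth_on_differentiable[OF S(3)])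
    finally show ?thesis .
  qed
  then show "D (\<lambda>z. D f z u) x v \<bullet> b = D (\<lambda>z. D f z v) x u \<bullet> b"
    using D_commute_real[OF S(1,2) smooth_on_inner_left[OF S(1,3)]] by simp
qed

section \<open>Product rule for families of linear maps\<close>

text \<open>Expanding the argument in the standard basis turns \<open>B z (f z)\<close> into a
  finite sum of products. Differentiability of B is thus required only for each fixed argument,
  which is the form in which metrics, Christoffel forms and Jacobians of chart changes come.\<close>

lemma has_derivative_linear_family:
  fixes B :: "'a::real_normed_vector \<Rightarrow> 'b::euclidean_space \<Rightarrow> 'c::real_normed_vector"
  assumes S: "open S" "x \<in> S"
    and lin: "\<And>z. z \<in> S \<Longrightarrow> linear (B z)"
    and B: "\<And>e. (\<lambda>z. B z e) differentiable (at x)"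
    and f: "(f has_derivative f') (at x)"
  shows "((\<lambda>z. B z (f z)) has_derivative (\<lambda>u. D (\<lambda>z. B z (f x)) x u + B x (f' u))) (at x)"
proof -
  have expand: "B z v = (\<Sum>i\<in>Basis. (v \<bullet> i) *\<^sub>R B z i)" if "z \<in> S" for z v
  proof -
    have "B z v = B z (\<Sum>i\<in>Basis. (v \<bullet> i) *\<^sub>R i)" by (simp add: euclidean_representation)
    also have "\<dots> = (\<Sum>i\<in>Basis. (v \<bullet> i) *\<^sub>R B z i)"
      using lin[OF that] by (simp add: linear_sum linear_cmul del: euclidean_representation_sum_fun)
    finally show ?thesis .
  qed
  have D_expand: "D (\<lambda>z. B z v) x u = (\<Sum>i\<in>Basis. (v \<bullet> i) *\<^sub>R D (\<lambda>z. B z i) x u)" for v u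
  proof -
    have "((\<lambda>z. \<Sum>i\<in>Basis. (v \<bullet> i) *\<^sub>R B z i) has_derivative
        (\<lambda>u. \<Sum>i\<in>Basis. (v \<bullet> i) *\<^sub>R D (\<lambda>z. B z i) x u)) (at x)"
      by (intro has_derivative_sum has_derivative_scaleR_right D_works B)
    then have "((\<lambda>z. B z v) has_derivative
        (\<lambda>u. \<Sum>i\<in>Basis. (v \<bullet> i) *\<^sub>R D (\<lambda>z. B z i) x u)) (at x)"
      by (rule has_derivative_transform_within_open[OF _ S]) (rule expand[symmetric])
    then show ?thesis by (simp add: D_eqI)
  qed
  have "((\<lambda>z. \<Sum>i\<in>Basis. (f z \<bullet> i) *\<^sub>R B z i) has_derivative
      (\<lambda>u. \<Sum>i\<in>Basis. (f x \<bullet> i) *\<^sub>R D (\<lambda>z. B z i) x u + (f' u \<bullet> i) *\<^sub>R B x i)) (at x)"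
    by (intro has_derivative_sum has_derivative_scaleR has_derivative_inner_left D_works B f)
  then have "((\<lambda>z. B z (f z)) has_derivative
      (\<lambda>u. \<Sum>i\<in>Basis. (f x \<bullet> i) *\<^sub>R D (\<lambda>z. B z i) x u + (f' u \<bullet> i) *\<^sub>R B x i)) (at x)"
    by (rule has_derivative_transform_within_open[OF _ S]) (rule expand[symmetric])
  moreover have "(\<lambda>u. \<Sum>i\<in>Basis. (f x \<bullet> i) *\<^sub>R D (\<lambda>z. B z i) x u + (f' u \<bullet> i) *\<^sub>R B x i)
      = (\<lambda>u. D (\<lambda>z. B z (f x)) x u + B x (f' u))"
    unfolding D_expand[of "f x"] expand[OF S(2), of "f' _"] sum.distrib ..
  ultimately show ?thesis by simp
qed

lemma D_linear_family:
  fixes B :: "'a::real_normed_vector \<Rightarrow> 'b::euclidean_space \<Rightarrow> 'c::real_normed_vector"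
  assumes S: "open S" "x \<in> S"
    and lin: "\<And>z. z \<in> S \<Longrightarrow> linear (B z)"
    and B: "\<And>e. (\<lambda>z. B z e) differentiable (at x)"
  shows "linear (\<lambda>e. D (\<lambda>z. B z e) x u)"
proof (rule linearI)
  fix e e' :: 'b and r :: real
  have "((\<lambda>z. B z e + B z e') has_derivative (\<lambda>u. D (\<lambda>z. B z e) x u + D (\<lambda>z. B z e') x u)) (at x)"
    by (intro has_derivative_add D_works B)
  then have "((\<lambda>z. B z (e + e')) has_derivative (\<lambda>u. D (\<lambda>z. B z e) x u + D (\<lambda>z. B z e') x u)) (at x)"
    by (rule has_derivative_transform_within_open[OF _ S]) (use lin linear_add in metis)
  then show "D (\<lambda>z. B z (e + e')) x u = D (\<lambda>z. B z e) x u + D (\<lambda>z. B z e') x u"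
    by (simp add: D_eqI)
  have "((\<lambda>z. r *\<^sub>R B z e) has_derivative (\<lambda>u. r *\<^sub>R D (\<lambda>z. B z e) x u)) (at x)"
    by (intro has_derivative_scaleR_right D_works B)
  then have "((\<lambda>z. B z (r *\<^sub>R e)) has_derivative (\<lambda>u. r *\<^sub>R D (\<lambda>z. B z e) x u)) (at x)"
    by (rule has_derivative_transform_within_open[OF _ S]) (use lin linear_cmul in metis)
  then show "D (\<lambda>z. B z (r *\<^sub>R e)) x u = r *\<^sub>R D (\<lambda>z. B z e) x u"
    by (simp add: D_eqI)
qed

section \<open>Local existence of integral curves\<close>

text \<open>Directional derivatives are continuous, hence bounded on a compact ball; since the ball
  is convex, a bound on the derivative is a Lipschitz constant.\<close>

lemma smooth_on_locally_lipschitz: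
  fixes F :: "'a::euclidean_space \<Rightarrow> 'b::euclidean_space"
  assumes "open S" "smooth_on S F" "x \<in> S"
  obtains r L where "r > 0" "cball x r \<subseteq> S" "L-lipschitz_on (cball x r) F"
proof -
  obtain r where r: "r > 0" "cball x r \<subseteq> S"
    using assms open_contains_cball by blast
  have "\<exists>b. \<forall>z\<in>cball x r. norm (D F z i) \<le> b" for i
  proof -
    have "continuous_on (cball x r) (\<lambda>z. D F z i)"
      by (rule continuous_on_subset[OF smooth_on_continuous[OF smooth_on_D[OF assms(2)]] r(2)])
    then have "compact ((\<lambda>z. D F z i) ` cball x r)"
      by (rule compact_continuous_image) simp
    from compact_imp_bounded[OF this] show ?thesis
      by (auto simp: bounded_iff)
  qed
  then obtain b where b: "\<And>i z. z \<in> cball x r \<Longrightarrow> norm (D F z i) \<le> b i" by metis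
  \<comment> \<open>Each coordinate of v is at most \<open>norm v\<close>, so the bounds for the
    basis vectors add up to a bound for the operator norm.\<close>
  define L where "L = (\<Sum>i\<in>Basis. b i)"
  have b0: "b i \<ge> 0" for i using b[of x i] r norm_ge_zero order_trans
    by (metis centre_in_cball less_imp_le)
  have on: "onorm (D F z) \<le> L" if z: "z \<in> cball x r" for z
  proof (rule onorm_bound)
    show "L \<ge> 0" by (simp add: L_def sum_nonneg b0)
    fix v :: 'a
    have lin: "linear (D F z)"
      using assms r z by (blast intro: linear_D smooth_on_differentiable)
    have "D F z v = D F z (\<Sum>i\<in>Basis. (v \<bullet> i) *\<^sub>R i)" by (simp add: euclidean_representation)
    also have "\<dots> = (\<Sum>i\<in>Basis. (v \<bullet> i) *\<^sub>R D F z i)"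
      using lin by (simp add: linear_sum linear_cmul del: euclidean_representation_sum_fun)
    finally have "norm (D F z v) \<le> (\<Sum>i\<in>Basis. norm ((v \<bullet> i) *\<^sub>R D F z i))"
      by (simp only: norm_sum)
    also have "\<dots> \<le> (\<Sum>i\<in>Basis. norm v * b i)"
      using b[OF z] b0 by (intro sum_mono) (auto intro!: mult_mono Basis_le_norm)
    finally show "norm (D F z v) \<le> L * norm v"
      by (simp add: L_def sum_distrib_left sum_distrib_right mult.commute)
  qed
  have "L-lipschitz_on (cball x r) F"
  proof (rule bounded_derivative_imp_lipschitz)
    show "(F has_derivative D F z) (at z within cball x r)" if "z \<in> cball x r" for z
      using that assms r by (meson D_works has_derivative_at_withinI smooth_on_differentiable subsetD)
    show "0 \<le> L" by (simp add: L_def sum_nonneg b0)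
  qed (use on in auto)
  with r show thesis by (intro that)
qed

text \<open>Banach's fixed point theorem for the Picard integral operator. A solution on a one-sided
  interval suffices, because it is only ever differentiated at time 0 from the right.\<close>

lemma picard_local_solution:
  fixes F :: "'a::euclidean_space \<Rightarrow> 'a"
  assumes r: "r > 0" and L: "L-lipschitz_on (cball x0 r) F"
  obtains T z where "T > 0" "z 0 = x0" "\<And>t. t \<in> {0..T} \<Longrightarrow> z t \<in> cball x0 r"
    "\<And>t. t \<in> {0..T} \<Longrightarrow> (z has_vector_derivative F (z t)) (at t within {0..T})"
proof -
  \<comment> \<open>Composing with the nearest-point map makes the field globally Lipschitz and bounded, so the
    Picard operator acts on all bounded continuous curves.\<close>
  define P where "P = closest_point (cball x0 r)"
  define F' where "F' = F \<circ> P"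
  define B where "B = norm (F x0) + L * r"
  have L0: "L \<ge> 0" using L by (rule lipschitz_on_nonneg)
  have cb: "convex (cball x0 r)" "closed (cball x0 r)" "cball x0 r \<noteq> {}"
    using r by auto
  have P_in: "P x \<in> cball x0 r" for x
    unfolding P_def by (rule closest_point_in_set[OF cb(2,3)])
  have P_id: "P x = x" if "x \<in> cball x0 r" for x
    unfolding P_def by (rule closest_point_self[OF that])
  have lip: "dist (F' x) (F' y) \<le> L * dist x y" for x y
  proof -
    have "dist (F' x) (F' y) \<le> L * dist (P x) (P y)"
      using lipschitz_onD[OF L P_in P_in] by (simp add: F'_def)
    also have "\<dots> \<le> L * dist x y"
      unfolding P_def by (intro mult_left_mono closest_point_lipschitz cb L0)
    finally show ?thesis .
  qed
  have F'_bound: "norm (F' x) \<le> B" for x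
  proof -
    have "dist (F (P x)) (F x0) \<le> L * dist (P x) x0"
      using r by (intro lipschitz_onD[OF L] P_in) auto
    also have "\<dots> \<le> L * r"
      using P_in[of x] by (intro mult_left_mono L0) (auto simp: dist_commute)
    finally show ?thesis
      using norm_triangle_ineq2[of "F (P x)" "F x0"] by (simp add: B_def F'_def dist_norm)
  qed
  have B0: "B \<ge> 0" using F'_bound[of x0] norm_ge_zero order_trans by blast
  have cont: "continuous_on U F'" for U
    using lipschitz_on_continuous_on[of L U F'] lip L0 by (auto simp: lipschitz_on_def)
  \<comment> \<open>The first bound gives \<open>B * T \<le> r\<close>, so Picard iterates stay in
    the ball; the second gives \<open>L * T \<le> 1/2\<close>, so the operator is a contraction. The
    added 1s keep the denominators nonzero.\<close>
  define T where "T = min (r / (B + 1)) (1 / (2 * (L + 1)))"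
  have T: "T > 0" using r B0 L0 by (simp add: T_def)
  have TB: "B * T \<le> r"
  proof -
    have "B * T \<le> B * (r / (B + 1))" using B0 by (intro mult_left_mono) (auto simp: T_def)
    also have "\<dots> \<le> r" using B0 r by (simp add: field_simps)
    finally show ?thesis .
  qed
  have TL: "L * T \<le> 1/2"
  proof -
    have "L * T \<le> L * (1 / (2 * (L + 1)))" using L0 by (intro mult_left_mono) (auto simp: T_def)
    also have "\<dots> \<le> 1/2" using L0 by (simp add: field_simps)
    finally show ?thesis .
  qed
  \<comment> \<open>Clamping time to [0, T] extends curves to the whole real line, so that the
    operator acts on the complete space of bounded continuous functions.\<close>
  define cl where "cl t = max 0 (min T t)" for t :: real
  have cl: "cl t \<in> {0..T}" for t using T by (auto simp: cl_def)
  have cl_id: "cl t = t" if "t \<in> {0..T}" for t using that by (auto simp: cl_def)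
  define \<Phi> where "\<Phi> \<gamma> t = x0 + integral {0..cl t} (\<lambda>s. F' (apply_bcontfun \<gamma> s))"
    for \<gamma> :: "real \<Rightarrow>\<^sub>C 'a" and t
  have cont\<gamma>: "continuous_on U (\<lambda>s. F' (apply_bcontfun \<gamma> s))" for U and \<gamma> :: "real \<Rightarrow>\<^sub>C 'a"
    by (rule continuous_on_compose2[OF cont[of UNIV]]) auto
  have \<Phi>_near: "norm (\<Phi> \<gamma> t - x0) \<le> r" for \<gamma> t
  proof -
    have "norm (integral {0..cl t} (\<lambda>s. F' (apply_bcontfun \<gamma> s))) \<le> B * (cl t - 0)"
      using cl[of t] by (intro integral_bound cont\<gamma> F'_bound) auto
    also have "\<dots> \<le> B * T" using cl[of t] B0 by (intro mult_left_mono) auto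
    finally show ?thesis using TB by (simp add: \<Phi>_def)
  qed
  have \<Phi>_cont: "\<Phi> \<gamma> \<in> bcontfun" for \<gamma>
  proof (rule bcontfun_normI)
    have "continuous_on {0..T} (\<lambda>t. integral {0..t} (\<lambda>s. F' (apply_bcontfun \<gamma> s)))"
      by (intro indefinite_integral_continuous_1 integrable_continuous_real cont\<gamma>)
    moreover have "continuous_on UNIV cl"
      unfolding cl_def by (intro continuous_intros)
    ultimately have "continuous_on UNIV (\<lambda>t. integral {0..cl t} (\<lambda>s. F' (apply_bcontfun \<gamma> s)))"
      by (rule continuous_on_compose2) (use cl in auto)
    then show "continuous_on UNIV (\<Phi> \<gamma>)"
      unfolding \<Phi>_def by (intro continuous_intros)
    show "norm (\<Phi> \<gamma> t) \<le> norm x0 + r" for t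
      using \<Phi>_near[of \<gamma> t] norm_triangle_ineq2[of "\<Phi> \<gamma> t" x0] by simp
  qed
  define \<Psi> where "\<Psi> \<gamma> = Bcontfun (\<Phi> \<gamma>)" for \<gamma>
  have \<Psi>: "apply_bcontfun (\<Psi> \<gamma>) t = \<Phi> \<gamma> t" for \<gamma> t
    unfolding \<Psi>_def using \<Phi>_cont by (simp add: Bcontfun_inverse)
  have "dist (\<Psi> \<gamma>) (\<Psi> \<delta>) \<le> (1/2) * dist \<gamma> \<delta>" for \<gamma> \<delta>
  proof (rule dist_bound)
    fix t
    have "norm (integral {0..cl t} (\<lambda>s. F' (apply_bcontfun \<gamma> s) - F' (apply_bcontfun \<delta> s)))
        \<le> (L * dist \<gamma> \<delta>) * (cl t - 0)"
    proof (intro integral_bound continuous_intros cont\<gamma>)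
      fix s
      have "dist (F' (apply_bcontfun \<gamma> s)) (F' (apply_bcontfun \<delta> s)) \<le> L * dist \<gamma> \<delta>"
        using lip[of "apply_bcontfun \<gamma> s" "apply_bcontfun \<delta> s"]
          mult_left_mono[OF dist_bounded[of \<gamma> s \<delta>] L0] by linarith
      then show "norm (F' (apply_bcontfun \<gamma> s) - F' (apply_bcontfun \<delta> s)) \<le> L * dist \<gamma> \<delta>"
        by (simp add: dist_norm)
    qed (use cl[of t] in auto)
    also have "\<dots> \<le> (L * dist \<gamma> \<delta>) * T"
      using cl[of t] L0 by (intro mult_left_mono) auto
    also have "\<dots> \<le> (1/2) * dist \<gamma> \<delta>"
      using mult_right_mono[OF TL, of "dist \<gamma> \<delta>"] by (simp add: mult_ac)
    finally have "norm (integral {0..cl t} (\<lambda>s. F' (apply_bcontfun \<gamma> s) - F' (apply_bcontfun \<delta> s)))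
        \<le> (1/2) * dist \<gamma> \<delta>" .
    moreover have "integral {0..cl t} (\<lambda>s. F' (apply_bcontfun \<gamma> s) - F' (apply_bcontfun \<delta> s))
        = \<Phi> \<gamma> t - \<Phi> \<delta> t"
      unfolding \<Phi>_def
      using Henstock_Kurzweil_Integration.integral_diff[OF integrable_continuous_real[OF cont\<gamma>]
          integrable_continuous_real[OF cont\<gamma>], of 0 "cl t" \<gamma> \<delta>] by simp
    ultimately show "dist (apply_bcontfun (\<Psi> \<gamma>) t) (apply_bcontfun (\<Psi> \<delta>) t) \<le> (1/2) * dist \<gamma> \<delta>"
      unfolding \<Psi> by (simp only: dist_norm[of "\<Phi> \<gamma> t"])
  qed
  then have "\<exists>!\<gamma>. \<Psi> \<gamma> = \<gamma>"
    by (intro banach_fix_type[of "1/2"]) simp_all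
  then obtain \<gamma> where "\<Psi> \<gamma> = \<gamma>" by blast
  then have \<gamma>: "apply_bcontfun \<gamma> t = \<Phi> \<gamma> t" for t by (metis \<Psi>)
  have in_ball: "apply_bcontfun \<gamma> t \<in> cball x0 r" for t
    using \<Phi>_near[of \<gamma> t] by (simp add: \<gamma> dist_norm norm_minus_commute)
  show thesis
  proof (rule that[OF T, of "apply_bcontfun \<gamma>"])
    show "apply_bcontfun \<gamma> 0 = x0" using \<gamma>[of 0] T by (simp add: \<Phi>_def cl_def)
    show "apply_bcontfun \<gamma> t \<in> cball x0 r" for t by (rule in_ball)
    fix t assume t: "t \<in> {0..T}"
    have "((\<lambda>t. x0 + integral {0..t} (\<lambda>s. F' (apply_bcontfun \<gamma> s))) has_vector_derivative
        0 + F' (apply_bcontfun \<gamma> t)) (at t within {0..T})"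
      by (intro has_vector_derivative_add has_vector_derivative_const
          integral_has_vector_derivative cont\<gamma> t)
    moreover have "x0 + integral {0..s} (\<lambda>s. F' (apply_bcontfun \<gamma> s)) = apply_bcontfun \<gamma> s"
      if "s \<in> {0..T}" for s
      using \<gamma>[of s] cl_id[OF that] by (simp add: \<Phi>_def)
    ultimately have "(apply_bcontfun \<gamma> has_vector_derivative F' (apply_bcontfun \<gamma> t)) (at t within {0..T})"
      using has_vector_derivative_transform[OF t, of "apply_bcontfun \<gamma>"
          "\<lambda>t. x0 + integral {0..t} (\<lambda>s. F' (apply_bcontfun \<gamma> s))"] by simp
    \<comment> \<open>The fixed point never leaves the ball, where the nearest-point map is the
      identity, so \<open>F'\<close> agrees with F along it.\<close>
    then show "(apply_bcontfun \<gamma> has_vector_derivative F (apply_bcontfun \<gamma> t)) (at t within {0..T})"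
      using in_ball by (simp add: F'_def P_id)
  qed
qed

section \<open>The conformal equation in a chart\<close>

lemma bilinear_linearD:
  assumes "bilinear B"
  shows "linear (B x)" "linear (\<lambda>x. B x y)"
  using assms by (auto simp: bilinear_def)

lemma linear_split:
  assumes "linear f"
  shows "f (x + y) = f x + f y" "f (x - y) = f x - f y" "f 0 = 0" "f (- x) = - f x"
  using assms by (simp_all add: linear_add linear_diff linear_0 linear_neg)

lemma D_fst:
  assumes "f differentiable (at (fst z))"
  shows "((\<lambda>z. f (fst z)) has_derivative (\<lambda>w. D f (fst z) (fst w))) (at z)"
  using has_derivative_compose[OF has_derivative_fst[OF has_derivative_ident] D_works[OF assms], of UNIV]
  by simp

lemma D_partial_left:
  assumes "V differentiable (at (x, y))"
  shows "((\<lambda>x. V (x, y)) has_derivative (\<lambda>u. D V (x, y) (u, 0))) (at x)"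
  using has_derivative_compose[OF has_derivative_Pair[OF has_derivative_ident has_derivative_const] D_works[OF assms], of UNIV]
  by simp

lemma D_partial_right:
  assumes "V differentiable (at (x, y))"
  shows "((\<lambda>y. V (x, y)) has_derivative (\<lambda>v. D V (x, y) (0, v))) (at y)"
  using has_derivative_compose[OF has_derivative_Pair[OF has_derivative_const has_derivative_ident] D_works[OF assms], of UNIV]
  by simp

text \<open>Integrating along segments and polarizing gives
  \<open>B (h y) z + B (h z) y = S y z\<close> for \<open>h y = f y - f 0\<close>. For fixed z both
  S and the second summand are linear in y, hence so is \<open>B (h y) z\<close>, and definiteness
  of B makes h linear.\<close>

lemma affine_if_symmetrized_derivative_constant:
  fixes B :: "'a::euclidean_space \<Rightarrow> 'a \<Rightarrow> real" and f :: "'a \<Rightarrow> 'a"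
  assumes B: "bilinear B" and sym: "\<And>u v. B u v = B v u" and pos: "\<And>u. u \<noteq> 0 \<Longrightarrow> B u u > 0"
    and f: "\<And>y. f differentiable (at y)"
    and S: "\<And>y u v. B (D f y u) v + B u (D f y v) = S u v"
  shows "linear (\<lambda>y. f y - f 0)" and "D f y u = f u - f 0"
proof -
  note lin = bilinear_linearD[OF B]
  note split = linear_split[OF lin(1)] linear_split[OF lin(2)]
  note split_D = linear_split[OF linear_D[OF f]]
  define h where "h y = f y - f 0" for y
  \<comment> \<open>Evaluating at the point 0 exhibits S as symmetric and bilinear, since
    \<open>D f 0\<close> is linear.\<close>
  have S_eq: "S u v = B (D f 0 u) v + B (D f 0 v) u" for u v
    using S[of 0 u v] sym by metis
  \<comment> \<open>On the segment from z to y the function \<open>B (f _) (y - z)\<close> has the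
    constant derivative \<open>S (y - z) (y - z) / 2\<close>.\<close>
  have increment: "2 * B (f y - f z) (y - z) = S (y - z) (y - z)" for y z
  proof -
    define w where "w = y - z"
    have "((\<lambda>s. B (f (z + s *\<^sub>R w)) w) has_real_derivative S w w / 2) (at s)" for s
    proof -
      have "bounded_linear (\<lambda>v. B v w)" using lin(2) linear_conv_bounded_linear by blast
      from bounded_linear.has_derivative[OF this D_works[OF f]]
      have d: "((\<lambda>y. B (f y) w) has_derivative (\<lambda>u. B (D f y u) w)) (at y)" for y .
      have "((\<lambda>s. B (f (z + s *\<^sub>R w)) w) has_real_derivative D (\<lambda>y. B (f y) w) (z + s *\<^sub>R w) w) (at s)"
        by (rule has_real_derivative_along_line) (rule differentiableI[OF d])
      moreover have "D (\<lambda>y. B (f y) w) (z + s *\<^sub>R w) w = S w w / 2"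
        using S[of "z + s *\<^sub>R w" w w] sym[of w] by (simp add: D_eqI[OF d])
      ultimately show ?thesis by simp
    qed
    from MVT2[of 0 1, OF _ this] show ?thesis
      by (auto simp: w_def split algebra_simps)
  qed
  \<comment> \<open>Expanding the increment for (y, z) and subtracting those for (y, 0) and (z, 0)
    leaves the mixed terms.\<close>
  have polar: "B (h y) z + B (h z) y = S y z" for y z
    using increment[of y z] increment[of y 0] increment[of z 0]
    by (simp add: h_def S_eq split split_D sym algebra_simps)
  have eqI: "w = w'" if "\<And>z. B w z = B w' z" for w w'
    using that[of "w - w'"] pos[of "w - w'"] by (auto simp: split)
  have "linear h"
  proof (rule linearI)
    show "h (y + y') = h y + h y'" for y y'
    proof (rule eqI)
      fix z
      show "B (h (y + y')) z = B (h y + h y') z"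
        using polar[of "y + y'" z] polar[of y z] polar[of y' z]
        by (simp add: S_eq split split_D)
    qed
    show "h (r *\<^sub>R y) = r *\<^sub>R h y" for r y
    proof (rule eqI)
      fix z
      have "B (h (r *\<^sub>R y)) z = r * (S y z - B (h z) y)"
        using polar[of "r *\<^sub>R y" z]
        by (simp add: S_eq linear_cmul[OF lin(1)] linear_cmul[OF lin(2)] linear_cmul[OF linear_D[OF f]] algebra_simps)
      then show "B (h (r *\<^sub>R y)) z = B (r *\<^sub>R h y) z"
        using polar[of y z] by (simp add: linear_cmul[OF lin(2)])
    qed
  qed
  then show "linear (\<lambda>y. f y - f 0)" by (simp add: h_def[abs_def])
  have "(h has_derivative h) (at y)"
    using \<open>linear h\<close> by (simp add: linear_imp_has_derivative)
  then have "((\<lambda>y. h y + f 0) has_derivative h) (at y)"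
    by (auto intro!: derivative_eq_intros)
  then show "D f y u = f u - f 0"
    by (simp add: h_def D_eqI)
qed

text \<open>In coordinates this is \<open>y\<^sup>j u\<^sup>i v\<^sup>l g\<^sub>k\<^sub>l \<Gamma>\<^sub>j\<^sub>i\<^sup>k\<close>.\<close>

definition christoffel1 ::
  "('a::real_normed_vector \<Rightarrow> 'a \<Rightarrow> 'a \<Rightarrow> real) \<Rightarrow> 'a \<Rightarrow> 'a \<Rightarrow> 'a \<Rightarrow> 'a \<Rightarrow> real" where
  "christoffel1 G x y u v =
     (D (\<lambda>z. G z u v) x y + D (\<lambda>z. G z y v) x u - D (\<lambda>z. G z y u) x v) / 2"

section \<open>A Riemannian metric on an open set of coordinates\<close>

locale local_metric =
  fixes U :: "'a::euclidean_space set" and G :: "'a \<Rightarrow> 'a \<Rightarrow> 'a \<Rightarrow> real"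
  assumes open_U: "open U"
    and bilinear_G: "\<And>x. x \<in> U \<Longrightarrow> bilinear (G x)"
    and sym_G: "\<And>x u v. x \<in> U \<Longrightarrow> G x u v = G x v u"
    and pos_G: "\<And>x u. x \<in> U \<Longrightarrow> u \<noteq> 0 \<Longrightarrow> G x u u > 0"
    and smooth_G: "\<And>u v. smooth_on U (\<lambda>x. G x u v)"
begin

abbreviation "H \<equiv> christoffel1 G"

lemma G_differentiable: "x \<in> U \<Longrightarrow> (\<lambda>x. G x u v) differentiable (at x)"
  by (rule smooth_on_differentiable[OF smooth_G])

lemmas linear_G = bilinear_linearD[OF bilinear_G]

lemma G_eqI:
  assumes x: "x \<in> U" and "\<And>z. G x w z = G x w' z"
  shows "w = w'"
  using assms(2)[of "w - w'"] pos_G[OF x, of "w - w'"] linear_split(2)[OF linear_G(2)[OF x]] by fastforce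

lemma linear_DG:
  assumes "x \<in> U"
  shows "linear (\<lambda>u. D (\<lambda>z. G z u v) x w)" "linear (\<lambda>v. D (\<lambda>z. G z u v) x w)"
    "linear (D (\<lambda>z. G z u v) x)"
  using assms
  by (auto intro: D_linear_family[OF open_U assms] linear_D linear_G G_differentiable)

lemma DG_sym: "x \<in> U \<Longrightarrow> D (\<lambda>z. G z u v) x w = D (\<lambda>z. G z v u) x w"
  using D_cong[OF open_U, of x "\<lambda>z. G z u v" "\<lambda>z. G z v u"] sym_G by simp

lemma linear_H:
  assumes x: "x \<in> U"
  shows "linear (\<lambda>y. H x y u v)" "linear (\<lambda>u. H x y u v)" "linear (\<lambda>v. H x y u v)"
  unfolding christoffel1_def
  by (rule linearI; simp add: linear_add[OF linear_DG(1)[OF x]] linear_add[OF linear_DG(2)[OF x]]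
      linear_add[OF linear_DG(3)[OF x]] linear_cmul[OF linear_DG(1)[OF x]]
      linear_cmul[OF linear_DG(2)[OF x]] linear_cmul[OF linear_DG(3)[OF x]] algebra_simps add_divide_distrib diff_divide_distrib)+

text \<open>This is compatibility of the Levi-Civita connection with the metric: in the sum of the
  two Christoffel forms the derivatives in directions y and v cancel.\<close>

lemma DG_eq_H: "x \<in> U \<Longrightarrow> D (\<lambda>z. G z y v) x u = H x y u v + H x v u y"
  by (simp add: christoffel1_def DG_sym[of _ y v] DG_sym[of _ y u] DG_sym[of _ u v] field_simps)

lemma DDG_differentiable: "x \<in> U \<Longrightarrow> (\<lambda>z. D (\<lambda>z. G z u v) z w) differentiable (at x)"
  by (rule smooth_on_differentiable[OF smooth_on_D[OF smooth_G]])

lemma H_differentiable: "x \<in> U \<Longrightarrow> (\<lambda>z. H z y u v) differentiable (at x)"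
  unfolding christoffel1_def using DDG_differentiable
  by (intro differentiable_diff differentiable_add differentiable_divide) auto

text \<open>The hypotheses \<open>vv\<close> and \<open>hv\<close> are the vertical-vertical
  component, divided by c, and the component on (u, 0) and (0, v) of the conformal equation. That X
  is a function of x alone expresses preservation of fibers.\<close>

lemma conformal_factor_derivative_zero:
  fixes X :: "'a \<Rightarrow> 'a" and V :: "'a \<times> 'a \<Rightarrow> 'a" and \<omega> :: "'a \<Rightarrow> real"
  assumes x: "x \<in> U" and c: "c \<noteq> 0"
    and X: "\<And>x. x \<in> U \<Longrightarrow> X differentiable (at x)"
    and V: "\<And>x y. x \<in> U \<Longrightarrow> V differentiable (at (x, y))"
    and \<omega>: "\<And>x. x \<in> U \<Longrightarrow> \<omega> differentiable (at x)"
    and vv: "\<And>x y u v. x \<in> U \<Longrightarrow>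
      D (\<lambda>z. G z u v) x (X x) + G x (D V (x, y) (0, u)) v + G x u (D V (x, y) (0, v)) = 2 * \<omega> x * G x u v"
    and hv: "\<And>x y u v. x \<in> U \<Longrightarrow>
      b * D (\<lambda>z. G z u v) x (X x) + c * (D (\<lambda>z. H z y u v) x (X x) + H x (V (x, y)) u v)
      + (b * G x (D X x u) v + c * (G x (D V (x, y) (u, 0)) v + H x y (D X x u) v))
      + (b * G x u (D V (x, y) (0, v)) + c * H x y u (D V (x, y) (0, v)))
      = 2 * \<omega> x * (b * G x u v + c * H x y u v)"
  shows "D \<omega> x u = 0"
proof -
  define h where "h x y = V (x, y) - V (x, 0)" for x y
  have DV: "D (\<lambda>y. V (x, y)) y v = D V (x, y) (0, v)" if "x \<in> U" for x y v
    by (simp add: D_eqI[OF D_partial_right[OF V[OF that]]])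
  \<comment> \<open>For fixed x, \<open>vv\<close> makes the symmetrized fiber derivative of V equal
    to \<open>2 * \<omega> x * G x u v\<close> minus the derivative of G along X, which does not
    involve y.\<close>
  have affine: "linear (h x)" "D V (x, y) (0, v) = h x v" if x: "x \<in> U" for x y v
  proof -
    have *: "(\<lambda>y. V (x, y)) differentiable (at y)" for y
      using D_partial_right[OF V[OF x]] by (rule differentiableI)
    have "G x (D (\<lambda>y. V (x, y)) y u) v + G x u (D (\<lambda>y. V (x, y)) y v)
       = 2 * \<omega> x * G x u v - D (\<lambda>z. G z u v) x (X x)" for y u v
      using vv[OF x, of u v y] by (simp add: DV[OF x])
    note aff = affine_if_symmetrized_derivative_constant[OF bilinear_G[OF x] sym_G[OF x] pos_G[OF x] * this]
    show "linear (h x)" using aff(1) by (simp add: h_def[abs_def])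
    show "D V (x, y) (0, v) = h x v" using aff(2)[of y v] by (simp add: h_def DV[OF x])
  qed
  define h' where "h' y = D V (x, y) (u, 0) - D V (x, 0) (u, 0)" for y
  have dh: "((\<lambda>x. h x y) has_derivative (\<lambda>w. D V (x, y) (w, 0) - D V (x, 0) (w, 0))) (at x)" for y
    unfolding h_def using D_partial_left[OF V[OF x]] by (intro has_derivative_diff)
  define X' where "X' = D X x u"
  note split_G = linear_split[OF linear_G(1)[OF x]] linear_split[OF linear_G(2)[OF x]]
  note split_H = linear_split[OF linear_H(1)[OF x]] linear_split[OF linear_H(2)[OF x]]
     linear_split[OF linear_H(3)[OF x]]
  have H0: "D (\<lambda>z. H z 0 u v) x w = 0" for u v w
    using D_cong[OF open_U x, of "\<lambda>z. H z 0 u v" "\<lambda>z. 0"] linear_0[OF linear_H(1)]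
    by (simp add: frechet_derivative_const)
  \<comment> \<open>Subtract \<open>hv\<close> at fiber point 0 from \<open>hv\<close> at y. All
    terms with factor b cancel, since \<open>D V (x, y) (0, v)\<close> does not depend on y, and the
    rest can be divided by c.\<close>
  have eq1: "G x (h' y) v = 2 * \<omega> x * H x y u v - D (\<lambda>z. H z y u v) x (X x) - H x (h x y) u v
      - H x y X' v - H x y u (h x v)" for y v
  proof -
    have "c * (D (\<lambda>z. H z y u v) x (X x) + H x (h x y) u v + G x (h' y) v + H x y X' v + H x y u (h x v))
      = c * (2 * \<omega> x * H x y u v)"
      using hv[OF x, where y=y and u=u and v=v] hv[OF x, where y=0 and u=u and v=v]
      by (simp add: affine(2)[OF x] split_G split_H H0 h'_def X'_def h_def algebra_simps)
    then show ?thesis using c by simp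
  qed
  \<comment> \<open>The left side of \<open>vv\<close>, with the fiber derivative of V already
    replaced by h, is differentiated in the base direction; y and v are now the two arguments of the
    metric.\<close>
  have lhs: "((\<lambda>x. D (\<lambda>z. G z y v) x (X x) + (G x (h x y) v + G x y (h x v))) has_derivative
      (\<lambda>u. D (\<lambda>z. D (\<lambda>z. G z y v) z (X x)) x u + D (\<lambda>z. G z y v) x (D X x u)
        + ((D (\<lambda>z. G z (h x y) v) x u + G x (D V (x, y) (u, 0) - D V (x, 0) (u, 0)) v)
          + (D (\<lambda>z. G z y (h x v)) x u + G x y (D V (x, v) (u, 0) - D V (x, 0) (u, 0)))))) (at x)" for y v
    using x
    by (intro has_derivative_add has_derivative_linear_family[OF open_U x] dh D_works[OF X])
      (auto intro: linear_G linear_DG G_differentiable DDG_differentiable)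
  have rhs: "((\<lambda>x. 2 * \<omega> x * G x y v) has_derivative
      (\<lambda>u. 2 * \<omega> x * D (\<lambda>z. G z y v) x u + 2 * D \<omega> x u * G x y v)) (at x)" for y v
    by (intro has_derivative_mult has_derivative_mult_right D_works \<omega> G_differentiable x)
  have eq2: "D (\<lambda>z. D (\<lambda>z. G z y v) z (X x)) x u + D (\<lambda>z. G z y v) x X'
        + (D (\<lambda>z. G z (h x y) v) x u + G x (h' y) v)
          + (D (\<lambda>z. G z y (h x v)) x u + G x y (h' v))
      = 2 * \<omega> x * D (\<lambda>z. G z y v) x u + 2 * D \<omega> x u * G x y v" for y v
  proof -
    have "D (\<lambda>x. D (\<lambda>z. G z y v) x (X x) + (G x (h x y) v + G x y (h x v))) x
        = D (\<lambda>x. 2 * \<omega> x * G x y v) x"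
    proof (rule D_cong[OF open_U x])
      fix z assume z: "z \<in> U"
      show "D (\<lambda>z. G z y v) z (X z) + (G z (h z y) v + G z y (h z v)) = 2 * \<omega> z * G z y v"
        using vv[OF z, of y v 0] by (simp add: affine(2)[OF z])
    qed
    then show ?thesis
      unfolding D_eqI[OF lhs] D_eqI[OF rhs] X'_def h'_def by (simp add: fun_eq_iff add.assoc)
  qed
  \<comment> \<open>With the vector \<open>X x\<close> frozen, second derivatives of the metric
    commute; metric compatibility is then differentiated along it.\<close>
  have DDG: "D (\<lambda>z. D (\<lambda>z. G z y v) z (X x)) x u = D (\<lambda>z. H z y u v) x (X x) + D (\<lambda>z. H z v u y) x (X x)" for y v
  proof -
    have "D (\<lambda>z. D (\<lambda>z. G z y v) z (X x)) x u = D (\<lambda>z. D (\<lambda>z. G z y v) z u) x (X x)"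
      by (rule D_commute[OF open_U x smooth_G])
    also have "\<dots> = D (\<lambda>z. H z y u v + H z v u y) x (X x)"
      using D_cong[OF open_U x, of "\<lambda>z. D (\<lambda>z. G z y v) z u" "\<lambda>z. H z y u v + H z v u y"]
      by (simp add: DG_eq_H)
    also have "\<dots> = D (\<lambda>z. H z y u v) x (X x) + D (\<lambda>z. H z v u y) x (X x)"
      using D_eqI[OF has_derivative_add[OF D_works[OF H_differentiable[OF x]] D_works[OF H_differentiable[OF x]]]]
      by simp
    finally show ?thesis .
  qed
  \<comment> \<open>Insert \<open>eq1\<close> for (y, v) and for (v, y) into \<open>eq2\<close>. By
    \<open>DG_eq_H\<close> the derivatives of G along \<open>X'\<close> and of G on (h y, v) and (y,
    h v) along u cancel the matching Christoffel terms, and so do the two multiples of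
    \<open>2 * \<omega> x\<close>.\<close>
  have "2 * D \<omega> x u * G x y v = 0" for y v
    using eq2[of y v] eq1[of y v] eq1[of v y] sym_G[OF x, of y "h' v"]
    by (simp add: DDG DG_eq_H[OF x] distrib_left)
  \<comment> \<open>A basis vector is nonzero, so the metric is positive on it and can be divided
    out.\<close>
  from this[of "SOME b. b \<in> Basis" "SOME b. b \<in> Basis"] show ?thesis
    using pos_G[OF x nonzero_Basis[OF SOME_Basis]] by auto
qed

end

section \<open>Charts and the tangent bundle\<close>

lemma chart_inv_in: "x \<in> chart_img c \<Longrightarrow> chart_inv c x \<in> chart_dom c"
  by (simp add: chart_inv_def inv_into_into)

lemma chart_chart_inv: "x \<in> chart_img c \<Longrightarrow> snd c (chart_inv c x) = x"
  by (simp add: chart_inv_def f_inv_into_f)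

text \<open>These properties mention no topology on the manifold, so they can be shared by the atlas
  of M and by \<open>tangent_atlas A\<close>, for whose carrier no topology is fixed.\<close>

locale diff_atlas =
  fixes A :: "('m, 'e::euclidean_space) chart set"
  assumes inj_chart: "c \<in> A \<Longrightarrow> inj_on (snd c) (chart_dom c)"
    and open_overlap: "c \<in> A \<Longrightarrow> d \<in> A \<Longrightarrow> open (snd c ` (chart_dom c \<inter> chart_dom d))"
    and transition_differentiable: "c \<in> A \<Longrightarrow> d \<in> A \<Longrightarrow> p \<in> chart_dom c \<Longrightarrow> p \<in> chart_dom d \<Longrightarrow>
      transition c d differentiable (at (snd c p))"
begin

lemma chart_inv_chart: "c \<in> A \<Longrightarrow> p \<in> chart_dom c \<Longrightarrow> chart_inv c (snd c p) = p"
  by (simp add: chart_inv_def inj_chart)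

lemma open_chart_img: "c \<in> A \<Longrightarrow> open (chart_img c)"
  using open_overlap[of c c] by simp

lemma transition_chart: "c \<in> A \<Longrightarrow> p \<in> chart_dom c \<Longrightarrow> transition c d (snd c p) = snd d p"
  by (simp add: transition_def chart_inv_chart)

text \<open>The chain rule gives the cocycle condition, by which a vector in one chart determines
  compatible components in all others.\<close>

lemma D_transition_trans:
  assumes "c \<in> A" "d \<in> A" "e \<in> A" "p \<in> chart_dom c" "p \<in> chart_dom d" "p \<in> chart_dom e"
  shows "D (transition d e) (snd d p) (D (transition c d) (snd c p) u) = D (transition c e) (snd c p) u"
proof -
  have "(transition d e \<circ> transition c d has_derivative
      D (transition d e) (snd d p) \<circ> D (transition c d) (snd c p)) (at (snd c p))"
    using D_works[OF transition_differentiable[OF assms(1,2,4,5)]]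
      D_works[OF transition_differentiable[OF assms(2,3,5,6)]] assms
    by (intro diff_chain_at) (simp_all add: transition_chart)
  then have "D (transition d e \<circ> transition c d) (snd c p) = D (transition d e) (snd d p) \<circ> D (transition c d) (snd c p)"
    by (rule D_eqI)
  moreover have "D (transition d e \<circ> transition c d) (snd c p) = D (transition c e) (snd c p)"
    using assms
    by (intro D_cong[of "snd c ` (chart_dom c \<inter> chart_dom d)"]) (auto simp: open_overlap transition_chart)
  ultimately show ?thesis by simp
qed

lemma D_transition_self:
  assumes "c \<in> A" "p \<in> chart_dom c"
  shows "D (transition c c) (snd c p) u = u"
proof -
  have "D (transition c c) (snd c p) = D (\<lambda>x. x) (snd c p)"
    using assms by (intro D_cong[OF open_chart_img[of c]]) (auto simp: transition_chart)
  then show ?thesis by (simp add: D_eqI[OF has_derivative_ident])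
qed

lemma tangent_of_in_tangent_space:
  assumes "c \<in> A" "p \<in> chart_dom c"
  shows "tangent_of A c p u \<in> tangent_space A p"
  using assms by (auto simp: tangent_space_def tangent_of_def D_transition_trans)

lemma tangent_of_same: "c \<in> A \<Longrightarrow> p \<in> chart_dom c \<Longrightarrow> tangent_of A c p u c = u"
  by (simp add: tangent_of_def D_transition_self)

text \<open>A single component determines a tangent vector. Equality holds at every chart, because
  both families are 0 at charts that are not in A or do not contain p.\<close>

lemma tangent_of_component:
  assumes "c \<in> A" "p \<in> chart_dom c" "w \<in> tangent_space A p"
  shows "tangent_of A c p (w c) = w"
proof
  fix d
  show "tangent_of A c p (w c) d = w d"
  proof (cases "d \<in> A \<and> p \<in> chart_dom d")
    case True
    then have "w d = D (transition c d) (snd c p) (w c)"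
      using assms unfolding tangent_space_def by blast
    with True show ?thesis by (simp add: tangent_of_def)
  next
    case False
    then have "w d = 0" using assms(3) unfolding tangent_space_def by blast
    with False show ?thesis by (auto simp: tangent_of_def)
  qed
qed

lemma tangent_of_transition:
  assumes "c \<in> A" "d \<in> A" "p \<in> chart_dom c" "p \<in> chart_dom d"
  shows "tangent_of A d p (D (transition c d) (snd c p) u) = tangent_of A c p u"
  using tangent_of_component[OF assms(2,4) tangent_of_in_tangent_space[OF assms(1,3)], of u] assms
  by (simp add: tangent_of_def)

end

lemma smooth_manifold_diff_atlas:
  assumes "smooth_manifold M A"
  shows "diff_atlas A"
proof
  fix c d :: "('a, 'b) chart" assume c: "c \<in> A"
  then have hom: "homeomorphic_map (subtopology M (chart_dom c)) (top_of_set (chart_img c)) (snd c)"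
    and op: "openin M (chart_dom c)" "open (chart_img c)"
    using assms by (auto simp: smooth_manifold_def)
  have sub: "chart_dom c \<subseteq> topspace M" by (rule openin_subset[OF op(1)])
  have "inj_on (snd c) (topspace (subtopology M (chart_dom c)))"
    using hom by (rule homeomorphic_imp_injective_map)
  then show "inj_on (snd c) (chart_dom c)"
    using sub by (simp add: Int_absorb1)
  assume d: "d \<in> A"
  then have "openin M (chart_dom d)"
    using assms by (auto simp: smooth_manifold_def)
  then have "openin (subtopology M (chart_dom c)) (chart_dom c \<inter> chart_dom d)"
    by (rule openin_subtopology_Int2)
  then have "openin (top_of_set (chart_img c)) (snd c ` (chart_dom c \<inter> chart_dom d))"
    using homeomorphic_imp_open_map[OF hom] by (simp add: open_map_def)
  then show "open (snd c ` (chart_dom c \<inter> chart_dom d))"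
    using op(2) openin_open_trans by blast
  fix p assume p: "p \<in> chart_dom c" "p \<in> chart_dom d"
  have "smooth_on (snd c ` (chart_dom c \<inter> chart_dom d)) (transition c d)"
    using assms c d by (simp add: smooth_manifold_def)
  then show "transition c d differentiable (at (snd c p))"
    using p by (auto intro: smooth_on_differentiable)
qed

locale manifold =
  fixes M :: "'m topology" and A :: "('m, 'e::euclidean_space) chart set"
  assumes smooth_manifold: "smooth_manifold M A"
begin

sublocale diff_atlas A
  by (rule smooth_manifold_diff_atlas[OF smooth_manifold])

abbreviation overlap :: "('m, 'e) chart \<Rightarrow> ('m, 'e) chart \<Rightarrow> 'e set" where
  "overlap c d \<equiv> snd c ` (chart_dom c \<inter> chart_dom d)"

lemma transition_smooth: "c \<in> A \<Longrightarrow> d \<in> A \<Longrightarrow> smooth_on (overlap c d) (transition c d)"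
  using smooth_manifold by (simp add: smooth_manifold_def)

lemma D_transition_differentiable:
  "c \<in> A \<Longrightarrow> d \<in> A \<Longrightarrow> x \<in> overlap c d \<Longrightarrow> (\<lambda>z. D (transition c d) z u) differentiable (at x)"
  using smooth_on_differentiable[OF smooth_on_D[OF transition_smooth]] by blast

lemma induced_dom: "chart_dom (induced_chart A c) = {q \<in> tangent_bundle A. fst q \<in> chart_dom c}"
  and induced_map: "snd (induced_chart A c) q = (snd c (fst q), snd q c)"
  by (simp_all add: induced_chart_def)

section \<open>The induced charts of the tangent bundle\<close>

lemma tangent_of_in_induced_dom:
  assumes "c \<in> A" "p \<in> chart_dom c"
  shows "(p, tangent_of A c p y) \<in> chart_dom (induced_chart A c)"
  using assms tangent_of_in_tangent_space[OF assms]
  by (auto simp: induced_dom tangent_bundle_def carrier_of_def)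

lemma induced_dom_cases:
  assumes "c \<in> A" "q \<in> chart_dom (induced_chart A c)"
  shows "fst q \<in> chart_dom c" "snd q \<in> tangent_space A (fst q)" "tangent_of A c (fst q) (snd q c) = snd q"
  using assms by (auto simp: induced_dom tangent_bundle_def intro: tangent_of_component)

lemma induced_inj:
  assumes c: "c \<in> A"
  shows "inj_on (snd (induced_chart A c)) (chart_dom (induced_chart A c))"
proof (rule inj_onI)
  fix q r assume q: "q \<in> chart_dom (induced_chart A c)" and r: "r \<in> chart_dom (induced_chart A c)"
    and eq: "snd (induced_chart A c) q = snd (induced_chart A c) r"
  have "snd c (fst q) = snd c (fst r)" and comp: "snd q c = snd r c"
    using eq by (simp_all add: induced_map)
  then have base: "fst q = fst r"
    using inj_onD[OF inj_chart[OF c]] induced_dom_cases(1)[OF c q] induced_dom_cases(1)[OF c r] by blast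
  have "snd q = tangent_of A c (fst q) (snd q c)"
    by (rule induced_dom_cases(3)[OF c q, symmetric])
  also have "\<dots> = snd r"
    unfolding base comp by (rule induced_dom_cases(3)[OF c r])
  finally show "q = r" using base by (simp add: prod_eq_iff)
qed

text \<open>Every vector is the component in c of some tangent vector at p, namely of
  \<open>tangent_of A c p\<close>, so induced charts fill whole fibers.\<close>

lemma induced_overlap:
  assumes c: "c \<in> A"
  shows "snd (induced_chart A c) ` (chart_dom (induced_chart A c) \<inter> chart_dom (induced_chart A d))
    = overlap c d \<times> (UNIV :: 'e set)" (is "?L = ?R")
proof (intro equalityI subsetI)
  fix z assume "z \<in> ?R"
  then obtain p where p: "p \<in> chart_dom c" "p \<in> chart_dom d" "fst z = snd c p" by auto
  have "(p, tangent_of A c p (snd z)) \<in> chart_dom (induced_chart A c) \<inter> chart_dom (induced_chart A d)"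
    using tangent_of_in_induced_dom[OF c p(1)] p(2) by (simp add: induced_dom)
  moreover have "z = snd (induced_chart A c) (p, tangent_of A c p (snd z))"
    using p c by (simp add: induced_map tangent_of_same prod_eq_iff)
  ultimately show "z \<in> ?L"
    by (rule rev_image_eqI)
next
  fix z assume "z \<in> ?L"
  then obtain q where "fst q \<in> chart_dom c \<inter> chart_dom d" "z = (snd c (fst q), snd q c)"
    unfolding induced_dom induced_map by blast
  then show "z \<in> ?R" by simp
qed

lemma induced_img: "c \<in> A \<Longrightarrow> chart_img (induced_chart A c) = chart_img c \<times> UNIV"
  using induced_overlap[of c c] by simp

lemma induced_inv:
  assumes c: "c \<in> A" and x: "x \<in> chart_img c"
  shows "chart_inv (induced_chart A c) (x, y) = (chart_inv c x, tangent_of A c (chart_inv c x) y)"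
proof -
  have p: "chart_inv c x \<in> chart_dom c" by (rule chart_inv_in[OF x])
  have "chart_inv (induced_chart A c) (snd (induced_chart A c) (chart_inv c x, tangent_of A c (chart_inv c x) y))
    = (chart_inv c x, tangent_of A c (chart_inv c x) y)"
    unfolding chart_inv_def[of "induced_chart A c"]
    by (rule inv_into_f_f[OF induced_inj[OF c] tangent_of_in_induced_dom[OF c p]])
  then show ?thesis
    using c p by (simp add: induced_map chart_chart_inv[OF x] tangent_of_same)
qed

lemma induced_transition:
  assumes c: "c \<in> A" and d: "d \<in> A" and x: "x \<in> overlap c d"
  shows "transition (induced_chart A c) (induced_chart A d) (x, y)
    = (transition c d x, D (transition c d) x y)"
proof -
  from x obtain p where "p \<in> chart_dom c" "p \<in> chart_dom d" "x = snd c p" by auto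
  then show ?thesis
    using c d by (simp add: transition_def[of "induced_chart A c"] induced_inv induced_map
        chart_inv_chart transition_chart tangent_of_def)
qed

text \<open>The second component contains a second derivative of the chart change applied to y. The
  same inhomogeneous term occurs in the transformation law of the Christoffel symbols and is
  absorbed by it in \<open>hor_ver_part\<close>.\<close>

lemma induced_transition_has_derivative:
  assumes c: "c \<in> A" and d: "d \<in> A" and x: "x \<in> overlap c d"
  shows "(transition (induced_chart A c) (induced_chart A d) has_derivative
    (\<lambda>(u, w). (D (transition c d) x u, D (\<lambda>z. D (transition c d) z y) x u + D (transition c d) x w)))
    (at (x, y))"
proof -
  let ?\<phi> = "transition c d" and ?O = "overlap c d \<times> (UNIV :: 'e set)"
  have O: "open ?O" "(x, y) \<in> ?O"
    using open_overlap[OF c d] x by (auto intro: open_Times)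
  have diff: "?\<phi> differentiable (at z)" if "z \<in> overlap c d" for z
    using that transition_differentiable[OF c d] by auto
  have Dd: "((\<lambda>z. D ?\<phi> (fst z) e) has_derivative (\<lambda>w. D (\<lambda>z. D ?\<phi> z e) x (fst w))) (at (x, y))" for e
    using D_fst[of "\<lambda>z. D ?\<phi> z e" "(x, y)"] D_transition_differentiable[OF c d x] by simp
  have lin: "linear (D ?\<phi> (fst z))" if "z \<in> ?O" for z
    using that by (intro linear_D diff) auto
  have "((\<lambda>z. (?\<phi> (fst z), D ?\<phi> (fst z) (snd z))) has_derivative
      (\<lambda>u. (D ?\<phi> (fst (x, y)) (fst u),
        D (\<lambda>z. D ?\<phi> (fst z) (snd (x, y))) (x, y) u + D ?\<phi> (fst (x, y)) (snd u)))) (at (x, y))"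
    by (intro has_derivative_Pair D_fst has_derivative_snd has_derivative_ident
        has_derivative_linear_family[where B="\<lambda>z. D ?\<phi> (fst z)", OF O lin differentiableI[OF Dd]])
      (simp add: diff[OF x])
  then have "((\<lambda>z. (?\<phi> (fst z), D ?\<phi> (fst z) (snd z))) has_derivative
    (\<lambda>(u, w). (D ?\<phi> x u, D (\<lambda>z. D ?\<phi> z y) x u + D ?\<phi> x w))) (at (x, y))"
    by (simp add: D_eqI[OF Dd] case_prod_beta')
  then show ?thesis
    by (rule has_derivative_transform_within_open[OF _ O]) (auto simp: induced_transition c d)
qed

lemma diff_atlas_tangent_atlas: "diff_atlas (tangent_atlas A)"
proof
  fix c' d' assume "c' \<in> tangent_atlas A"
  then obtain c where c: "c \<in> A" "c' = induced_chart A c" by (auto simp: tangent_atlas_def)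
  then show "inj_on (snd c') (chart_dom c')" by (simp add: induced_inj)
  assume "d' \<in> tangent_atlas A"
  then obtain d where d: "d \<in> A" "d' = induced_chart A d" by (auto simp: tangent_atlas_def)
  show "open (snd c' ` (chart_dom c' \<inter> chart_dom d'))"
    unfolding c(2) d(2) induced_overlap[OF c(1)]
    by (intro open_Times open_overlap c d open_UNIV)
  fix q assume q: "q \<in> chart_dom c'" "q \<in> chart_dom d'"
  then have "snd c (fst q) \<in> overlap c d" by (auto simp: c(2) d(2) induced_dom)
  then show "transition c' d' differentiable (at (snd c' q))"
    using differentiableI[OF induced_transition_has_derivative[OF c(1) d(1)]]
    by (simp add: c(2) d(2) induced_map)
qed

sublocale TM: diff_atlas "tangent_atlas A"
  by (rule diff_atlas_tangent_atlas)

lemma carrier_tangent_atlas: "carrier_of (tangent_atlas A) = tangent_bundle A"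
  by (auto simp: carrier_of_def tangent_atlas_def induced_dom tangent_bundle_def)

end

section \<open>Christoffel symbols and lift metrics\<close>

lemma linear_axis_expansion:
  fixes f :: "real^'n \<Rightarrow> real"
  assumes "linear f"
  shows "f u = (\<Sum>i\<in>UNIV. u $ i * f (axis i 1))"
proof -
  have "f u = f (\<Sum>i\<in>UNIV. u $ i *\<^sub>R axis i 1)"
    using basis_expansion[of u] by (simp add: scalar_mult_eq_scaleR)
  then show ?thesis
    using assms by (simp add: linear_sum linear_cmul)
qed

lemma matrix_mul_matrix_inv: "invertible B \<Longrightarrow> B ** matrix_inv B = mat 1"
  unfolding invertible_def matrix_inv_def by (rule someI2_ex) auto

locale riemannian = manifold M A
  for M :: "'m topology" and A :: "('m, real^'n) chart set" +
  fixes g :: "('m, real^'n) tensor2"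
  assumes metric: "riemannian_metric A g"
begin

abbreviation "G c \<equiv> tensor_in A c g"

lemma local_metric: "c \<in> A \<Longrightarrow> local_metric (chart_img c) (G c)"
  using metric open_chart_img[of c] unfolding riemannian_metric_def local_metric_def by blast

lemma G_transition:
  assumes c: "c \<in> A" and d: "d \<in> A" and x: "x \<in> overlap c d"
  shows "G c x u v = G d (transition c d x) (D (transition c d) x u) (D (transition c d) x v)"
proof -
  from x obtain p where "p \<in> chart_dom c" "p \<in> chart_dom d" "x = snd c p" by auto
  then show ?thesis
    using c d by (simp add: tensor_in_def chart_inv_chart transition_chart tangent_of_transition)
qed

lemma transition_in_img:
  assumes "c \<in> A" "x \<in> overlap c d"
  shows "transition c d x \<in> chart_img d"
  using assms by (auto simp: transition_chart)

text \<open>Differentiating \<open>G_transition\<close> produces six terms with second derivatives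
  of the chart change. By their symmetry four cancel in pairs and the remaining two are equal, which
  the division by 2 turns into one.\<close>

lemma christoffel1_transition:
  assumes c: "c \<in> A" and d: "d \<in> A" and x: "x \<in> overlap c d"
  shows "christoffel1 (G c) x y u v =
    christoffel1 (G d) (transition c d x) (D (transition c d) x y) (D (transition c d) x u) (D (transition c d) x v)
    + G d (transition c d x) (D (\<lambda>z. D (transition c d) z y) x u) (D (transition c d) x v)"
proof -
  interpret d: local_metric "chart_img d" "G d" by (rule local_metric[OF d])
  let ?O = "overlap c d" and ?\<phi> = "transition c d"
  have O: "open ?O" by (rule open_overlap[OF c d])
  have \<phi>: "?\<phi> z \<in> chart_img d" if "z \<in> ?O" for z
    using transition_in_img[OF c that] .
  have d\<phi>: "(?\<phi> has_derivative D ?\<phi> x) (at x)"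
    using x transition_differentiable[OF c d] by (auto intro: D_works)
  \<comment> \<open>The product rule is built up in three stages: moving base point, then moving
    second argument, then moving first argument.\<close>
  have 1: "((\<lambda>z. G d (?\<phi> z) e e') has_derivative (\<lambda>w. D (\<lambda>z. G d z e e') (?\<phi> x) (D ?\<phi> x w))) (at x)" for e e'
    by (rule has_derivative_compose[OF d\<phi> D_works[OF d.G_differentiable[OF \<phi>[OF x]]]])
  have 2: "((\<lambda>z. G d (?\<phi> z) e (D ?\<phi> z v)) has_derivative
      (\<lambda>w. D (\<lambda>z. G d z e (D ?\<phi> x v)) (?\<phi> x) (D ?\<phi> x w) + G d (?\<phi> x) e (D (\<lambda>z. D ?\<phi> z v) x w))) (at x)" for e v
    using has_derivative_linear_family[OF O x, of "\<lambda>z. G d (?\<phi> z) e" "\<lambda>z. D ?\<phi> z v"]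
      D_works[OF D_transition_differentiable[OF c d x]] differentiableI[OF 1]
    by (simp add: \<phi> d.linear_G(1) D_eqI[OF 1])
  have 3: "((\<lambda>z. G d (?\<phi> z) (D ?\<phi> z u) (D ?\<phi> z v)) has_derivative
      (\<lambda>w. D (\<lambda>z. G d z (D ?\<phi> x u) (D ?\<phi> x v)) (?\<phi> x) (D ?\<phi> x w)
        + G d (?\<phi> x) (D ?\<phi> x u) (D (\<lambda>z. D ?\<phi> z v) x w)
        + G d (?\<phi> x) (D (\<lambda>z. D ?\<phi> z u) x w) (D ?\<phi> x v))) (at x)" for u v
    using has_derivative_linear_family[OF O x, of "\<lambda>z e. G d (?\<phi> z) e (D ?\<phi> z v)" "\<lambda>z. D ?\<phi> z u"]
      D_works[OF D_transition_differentiable[OF c d x]] differentiableI[OF 2]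
    by (simp add: \<phi> d.linear_G(2) D_eqI[OF 2])
  have DG: "D (\<lambda>z. G c z u v) x w = D (\<lambda>z. G d z (D ?\<phi> x u) (D ?\<phi> x v)) (?\<phi> x) (D ?\<phi> x w)
        + G d (?\<phi> x) (D ?\<phi> x u) (D (\<lambda>z. D ?\<phi> z v) x w)
        + G d (?\<phi> x) (D (\<lambda>z. D ?\<phi> z u) x w) (D ?\<phi> x v)" for u v w
    using D_cong[OF O x, of "\<lambda>z. G c z u v" "\<lambda>z. G d (?\<phi> z) (D ?\<phi> z u) (D ?\<phi> z v)"]
    by (simp add: G_transition[OF c d] D_eqI[OF 3])
  note sym = d.sym_G[OF \<phi>[OF x]]
  have comm: "D (\<lambda>z. D ?\<phi> z u) x v = D (\<lambda>z. D ?\<phi> z v) x u" for u v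
    by (rule D_commute[OF O x transition_smooth[OF c d]])
  show ?thesis
    unfolding christoffel1_def DG
    by (simp add: comm[of u y] comm[of v y] comm[of v u] sym[of "D ?\<phi> x y"] sym[of "D ?\<phi> x u"] add_divide_distrib diff_divide_distrib)
qed

text \<open>The correction that \<open>ver_part\<close> adds to the fiber component.\<close>

definition \<Gamma> :: "('m, real^'n) chart \<Rightarrow> real^'n \<Rightarrow> real^'n \<Rightarrow> real^'n \<Rightarrow> real^'n" where
  "\<Gamma> c x y u = (\<chi> h. \<Sum>j\<in>UNIV. \<Sum>i\<in>UNIV. y $ j * christoffel A c g x h j i * u $ i)"

lemma \<Gamma>_zero: "\<Gamma> c x y 0 = 0"
  by (simp add: \<Gamma>_def vec_eq_iff)

text \<open>\<open>christoffel\<close> is the symbol of the first kind with an index raised by the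
  inverse Gram matrix; pairing with the metric lowers it again.\<close>

lemma G_\<Gamma>:
  assumes c: "c \<in> A" and x: "x \<in> chart_img c"
  shows "G c x (\<Gamma> c x y u) v = christoffel1 (G c) x y u v"
proof -
  interpret local_metric "chart_img c" "G c" by (rule local_metric[OF c])
  let ?m = "gmat A c g x" and ?e = "\<lambda>i. axis i (1::real) :: real^'n"
  have G_inner: "G c x u v = u \<bullet> (?m *v v)" for u v
    unfolding linear_axis_expansion[OF linear_G(2)[OF x], of u v]
      linear_axis_expansion[OF linear_G(1)[OF x], of "?e _" v]
    by (simp add: inner_vec_def matrix_vector_mult_def gmat_def mult.commute)
  \<comment> \<open>Positive definiteness makes the kernel of the Gram matrix trivial, so
    \<open>matrix_inv\<close> is a genuine inverse.\<close>
  have "z = 0" if "?m *v z = 0" for z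
    using pos_G[OF x, of z] that by (force simp: G_inner)
  then have inv: "?m ** matrix_inv ?m = mat 1"
    by (intro matrix_mul_matrix_inv) (simp add: invertible_left_inverse matrix_left_invertible_ker)
  have chr: "christoffel A c g x h j i = (\<Sum>l\<in>UNIV. matrix_inv ?m $ h $ l * H x (?e j) (?e i) (?e l))" for h i j
    by (simp add: christoffel_def dgmat_def gmat_def christoffel1_def sum_divide_distrib)
  define w where "w = (\<chi> l. H x y u (?e l))"
  have "\<Gamma> c x y u = matrix_inv ?m *v w"
  proof (rule vec_eq_iff[THEN iffD2], rule allI)
    fix h
    have "\<Gamma> c x y u $ h = (\<Sum>j\<in>UNIV. \<Sum>i\<in>UNIV. \<Sum>l\<in>UNIV. matrix_inv ?m $ h $ l * (y $ j * (u $ i * H x (?e j) (?e i) (?e l))))"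
      by (simp add: \<Gamma>_def chr sum_distrib_left sum_distrib_right mult_ac)
    also have "\<dots> = (\<Sum>l\<in>UNIV. \<Sum>j\<in>UNIV. \<Sum>i\<in>UNIV. matrix_inv ?m $ h $ l * (y $ j * (u $ i * H x (?e j) (?e i) (?e l))))"
      by (subst sum.swap[of _ UNIV UNIV], subst sum.swap[of _ UNIV UNIV]) (rule refl)
    also have "\<dots> = (\<Sum>l\<in>UNIV. matrix_inv ?m $ h $ l * H x y u (?e l))"
      unfolding linear_axis_expansion[OF linear_H(1)[OF x], of y u]
        linear_axis_expansion[OF linear_H(2)[OF x], of "?e _" u]
      by (simp add: sum_distrib_left)
    finally show "\<Gamma> c x y u $ h = (matrix_inv ?m *v w) $ h"
      by (simp add: matrix_vector_mult_def w_def)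
  qed
  then have "?m *v \<Gamma> c x y u = w"
    by (simp add: matrix_vector_mul_assoc inv)
  then have "G c x v (\<Gamma> c x y u) = (\<Sum>l\<in>UNIV. v $ l * H x y u (?e l))"
    by (simp add: G_inner inner_vec_def w_def)
  also have "\<dots> = H x y u v"
    by (rule linear_axis_expansion[OF linear_H(3)[OF x], symmetric])
  finally show ?thesis by (simp add: sym_G[OF x])
qed

text \<open>The classical transformation law of the connection coefficients. It is tested against an
  arbitrary vector z, where it becomes the law for symbols of the first kind.\<close>

lemma \<Gamma>_transition:
  assumes c: "c \<in> A" and d: "d \<in> A" and x: "x \<in> overlap c d"
  shows "D (transition c d) x (\<Gamma> c x y u) =
    \<Gamma> d (transition c d x) (D (transition c d) x y) (D (transition c d) x u) + D (\<lambda>z. D (transition c d) z y) x u"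
proof -
  interpret d: local_metric "chart_img d" "G d" by (rule local_metric[OF d])
  have \<phi>: "transition c d x \<in> chart_img d" by (rule transition_in_img[OF c x])
  have xc: "x \<in> chart_img c" using x by auto
  show ?thesis
  proof (rule d.G_eqI[OF \<phi>])
    fix z
    obtain p where p: "p \<in> chart_dom c" "p \<in> chart_dom d" "x = snd c p" using x by auto
    \<comment> \<open>Writing z as the image of a vector in chart c lets \<open>G_transition\<close>
      carry the left side back to c.\<close>
    define v where "v = D (transition d c) (snd d p) z"
    have z: "z = D (transition c d) x v"
      using D_transition_trans[OF d c d p(2,1,2), of z] D_transition_self[OF d p(2)] p(3) by (simp add: v_def)
    show "G d (transition c d x) (D (transition c d) x (\<Gamma> c x y u)) z =
      G d (transition c d x) (\<Gamma> d (transition c d x) (D (transition c d) x y) (D (transition c d) x u)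
        + D (\<lambda>z. D (transition c d) z y) x u) z"
      unfolding z G_transition[OF c d x, symmetric] G_\<Gamma>[OF c xc] christoffel1_transition[OF c d x]
      by (simp add: linear_add[OF d.linear_G(2)[OF \<phi>]] G_\<Gamma>[OF d \<phi>])
  qed
qed

text \<open>The components in c are immediate; the point is that both families agree with
  \<open>tangent_of\<close> in every other chart. For the vertical part this is exactly
  \<open>\<Gamma>_transition\<close>.\<close>

lemma hor_ver_part:
  fixes x y u w :: "real^'n"
  assumes c: "c \<in> A" and x: "x \<in> chart_img c"
  defines "p \<equiv> chart_inv c x" and "q \<equiv> chart_inv (induced_chart A c) (x, y)"
  defines "\<xi> \<equiv> tangent_of (tangent_atlas A) (induced_chart A c) q (u, w)"
  shows "hor_part A q \<xi> = tangent_of A c p u"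
    and "ver_part A g q \<xi> = tangent_of A c p (w + \<Gamma> c x y u)"
proof -
  have p: "p \<in> chart_dom c" "snd c p = x"
    using x by (simp_all add: p_def chart_inv_in chart_chart_inv)
  have q: "q = (p, tangent_of A c p y)" "snd (induced_chart A c) q = (x, y)"
    using c p by (simp_all add: q_def p_def induced_inv[OF c x] induced_map tangent_of_same)
  have comp: "fst (\<xi> (induced_chart A d)) = D (transition c d) x u"
    "snd (\<xi> (induced_chart A d)) = D (\<lambda>z. D (transition c d) z y) x u + D (transition c d) x w"
    "linear (D (transition c d) x)" "x \<in> overlap c d"
    if d: "d \<in> A" "p \<in> chart_dom d" for d
  proof -
    show xo: "x \<in> overlap c d" using p d by auto
    have "q \<in> chart_dom (induced_chart A d)"
      using tangent_of_in_induced_dom[OF c p(1), of y] d q by (simp add: induced_dom)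
    then have "\<xi> (induced_chart A d) = D (transition (induced_chart A c) (induced_chart A d)) (x, y) (u, w)"
      using d q by (simp add: \<xi>_def tangent_of_def tangent_atlas_def)
    also have "\<dots> = (D (transition c d) x u, D (\<lambda>z. D (transition c d) z y) x u + D (transition c d) x w)"
      by (simp add: D_eqI[OF induced_transition_has_derivative[OF c d(1) xo]])
    finally show "fst (\<xi> (induced_chart A d)) = D (transition c d) x u"
      "snd (\<xi> (induced_chart A d)) = D (\<lambda>z. D (transition c d) z y) x u + D (transition c d) x w"
      by simp_all
    show "linear (D (transition c d) x)"
      using linear_D[OF transition_differentiable[OF c d(1) p(1) d(2)]] p(2) by simp
  qed
  show "hor_part A q \<xi> = tangent_of A c p u"
    by (rule ext) (simp add: hor_part_def tangent_of_def q(1) p comp(1))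
  show "ver_part A g q \<xi> = tangent_of A c p (w + \<Gamma> c x y u)"
  proof (rule ext)
    fix d
    show "ver_part A g q \<xi> d = tangent_of A c p (w + \<Gamma> c x y u) d"
    proof (cases "d \<in> A \<and> p \<in> chart_dom d")
      case True
      then have d: "d \<in> A" "p \<in> chart_dom d" by simp_all
      have [simp]: "snd q d = D (transition c d) x y" "snd d p = transition c d x"
        using d p transition_chart[OF c p(1)] by (simp_all add: q(1) tangent_of_def)
      have "ver_part A g q \<xi> d = snd (\<xi> (induced_chart A d))
          + \<Gamma> d (transition c d x) (D (transition c d) x y) (fst (\<xi> (induced_chart A d)))"
        using d by (simp add: ver_part_def \<Gamma>_def q(1)[THEN arg_cong[of _ _ fst]] vec_eq_iff)
      also have "\<dots> = D (transition c d) x (w + \<Gamma> c x y u)"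
        unfolding comp(1,2)[OF d] linear_add[OF comp(3)[OF d]] \<Gamma>_transition[OF c d(1) comp(4)[OF d]]
        by (simp add: add_ac)
      finally show ?thesis using d p(2) by (simp add: tangent_of_def)
    next
      case False
      then show ?thesis by (auto simp: ver_part_def tangent_of_def q(1))
    qed
  qed
qed

lemma tensor_in_lift_metric:
  assumes c: "c \<in> A" and x: "x \<in> chart_img c"
  shows "tensor_in (tangent_atlas A) (induced_chart A c) (lift_metric A g k l m) (x, y) (u, w) (u', w') =
    k * G c x u u' + l * (G c x u (w' + \<Gamma> c x y u') + G c x (w + \<Gamma> c x y u) u')
    + m * G c x (w + \<Gamma> c x y u) (w' + \<Gamma> c x y u')"
  unfolding tensor_in_def[of "tangent_atlas A"] lift_metric_def lift_metric1_def lift_metric2_def lift_metric3_def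
    hor_ver_part[OF c x]
  by (simp add: tensor_in_def induced_inv[OF c x])

text \<open>The horizontal part of (0, v) vanishes, so the connection enters only once and only
  through the form of the first kind, free of inverse matrices.\<close>

lemma tensor_in_lift_metric_vertical:
  assumes c: "c \<in> A" and x: "x \<in> chart_img c"
  shows "tensor_in (tangent_atlas A) (induced_chart A c) (lift_metric A g k l m) (x, y) (u, w) (0, v) =
    l * G c x u v + m * (G c x w v + christoffel1 (G c) x y u v)"
proof -
  interpret local_metric "chart_img c" "G c" by (rule local_metric[OF c])
  show ?thesis
    by (simp add: tensor_in_lift_metric[OF c x] \<Gamma>_zero linear_0[OF linear_G(1)[OF x]]
        linear_add[OF linear_G(2)[OF x]] G_\<Gamma>[OF c x])
qed

end

section \<open>Fiber-preserving fields\<close>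

text \<open>Picard's theorem is applied to the coordinate expression in c, and the curve is then
  checked in every other chart. Restricting one solution to \<open>closed_segment 0 t\<close> serves
  all times t at once.\<close>

lemma (in diff_atlas) local_flow:
  assumes X: "vector_field A X" and c: "c \<in> A" and x: "x \<in> chart_img c"
  obtains T z where "T > 0" "z 0 = x" "\<And>t. t \<in> {0..T} \<Longrightarrow> z t \<in> chart_img c"
    "\<And>t. t \<in> {0..T} \<Longrightarrow> (z has_vector_derivative vf_in c X (z t)) (at t within {0..T})"
    "\<And>t. t \<in> {0..T} \<Longrightarrow> flow_rel A X t (chart_inv c x) (chart_inv c (z t))"
proof -
  have "smooth_on (chart_img c) (vf_in c X)"
    using X c by (simp add: vector_field_def)
  from smooth_on_locally_lipschitz[OF open_chart_img[OF c] this x] obtain r L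
    where r: "r > 0" "cball x r \<subseteq> chart_img c" "L-lipschitz_on (cball x r) (vf_in c X)" .
  from picard_local_solution[OF r(1,3)] obtain T z where T: "T > 0" and z: "z 0 = x"
    "\<And>t. t \<in> {0..T} \<Longrightarrow> z t \<in> cball x r"
    "\<And>t. t \<in> {0..T} \<Longrightarrow> (z has_vector_derivative vf_in c X (z t)) (at t within {0..T})"
    by blast
  have z_in: "z t \<in> chart_img c" if "t \<in> {0..T}" for t
    using z(2)[OF that] r(2) by blast
  let ?\<gamma> = "\<lambda>t. chart_inv c (z t)"
  have "integral_curve A X (closed_segment 0 t) ?\<gamma>" if t: "t \<in> {0..T}" for t
    unfolding integral_curve_def
  proof (intro ballI conjI impI)
    fix s assume "s \<in> closed_segment 0 t"
    then have s: "s \<in> {0..T}" using t by (auto simp: closed_segment_eq_real_ivl)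
    have sub: "closed_segment 0 t \<subseteq> {0..T}" using t by (auto simp: closed_segment_eq_real_ivl)
    have zs: "?\<gamma> s \<in> chart_dom c" "snd c (?\<gamma> s) = z s"
      using chart_inv_in[OF z_in[OF s]] chart_chart_inv[OF z_in[OF s]] by blast+
    then show carrier: "?\<gamma> s \<in> carrier_of A" using c by (auto simp: carrier_of_def)
    fix d assume d: "d \<in> A" "?\<gamma> s \<in> chart_dom d"
    have dz: "(z has_vector_derivative X (?\<gamma> s) c) (at s within closed_segment 0 t)"
      using has_vector_derivative_within_subset[OF z(3)[OF s] sub] by (simp add: vf_in_def)
    have inv_overlap: "chart_inv c w \<in> chart_dom d" if "w \<in> snd c ` (chart_dom c \<inter> chart_dom d)" for w
    proof -
      from that obtain p where "p \<in> chart_dom c" "p \<in> chart_dom d" "w = snd c p" by blast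
      then show ?thesis by (simp add: chart_inv_chart[OF c])
    qed
    \<comment> \<open>The solution is continuous and the overlap is open, which yields the
      \<open>eventually\<close> clause of \<open>integral_curve\<close>.\<close>
    have "(z \<longlongrightarrow> z s) (at s within closed_segment 0 t)"
      using has_vector_derivative_continuous[OF dz] by (simp add: continuous_within)
    moreover have "z s \<in> snd c ` (chart_dom c \<inter> chart_dom d)"
      using zs d by (metis IntI imageI)
    ultimately have "\<forall>\<^sub>F r in at s within closed_segment 0 t. z r \<in> snd c ` (chart_dom c \<inter> chart_dom d)"
      by (intro topological_tendstoD open_overlap[OF c d(1)])
    then show "\<forall>\<^sub>F r in at s within closed_segment 0 t. ?\<gamma> r \<in> chart_dom d"
      by (rule eventually_mono) (rule inv_overlap)
    have "(transition c d has_derivative D (transition c d) (z s)) (at (z s))"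
      using transition_differentiable[OF c d(1) zs(1) d(2)] zs(2) by (simp add: D_works)
    then have "(transition c d \<circ> z has_vector_derivative D (transition c d) (z s) (X (?\<gamma> s) c))
        (at s within closed_segment 0 t)"
      by (rule vector_derivative_diff_chain_within[OF dz has_derivative_at_withinI])
    moreover have "D (transition c d) (z s) (X (?\<gamma> s) c) = X (?\<gamma> s) d"
    proof -
      have "X (?\<gamma> s) \<in> tangent_space A (?\<gamma> s)" using X carrier by (simp add: vector_field_def)
      then have "tangent_of A c (?\<gamma> s) (X (?\<gamma> s) c) d = X (?\<gamma> s) d"
        using tangent_of_component[OF c zs(1)] by simp
      then show ?thesis using d zs(2) by (simp add: tangent_of_def)
    qed
    ultimately show "((\<lambda>r. snd d (?\<gamma> r)) has_vector_derivative X (?\<gamma> s) d) (at s within closed_segment 0 t)"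
      by (simp add: transition_def o_def)
  qed
  then have "flow_rel A X t (chart_inv c x) (?\<gamma> t)" if "t \<in> {0..T}" for t
    unfolding flow_rel_def using that z(1) by (intro exI[of _ ?\<gamma>]) simp
  with T z z_in show thesis by (intro that)
qed

context manifold
begin

text \<open>Integral curves from (x, y) and (x, y') lie in a common fiber at each small time, so
  their base coordinates coincide and so do the derivatives of these at time 0.\<close>

lemma fiber_preserving_horizontal:
  assumes X: "vector_field (tangent_atlas A) X" and fib: "fiber_preserving A X"
    and c: "c \<in> A" and x: "x \<in> chart_img c"
  shows "fst (vf_in (induced_chart A c) X (x, y)) = fst (vf_in (induced_chart A c) X (x, y'))"
proof -
  let ?c = "induced_chart A c"
  have c': "?c \<in> tangent_atlas A" using c by (simp add: tangent_atlas_def)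
  have in_img: "(x, y) \<in> chart_img ?c" "(x, y') \<in> chart_img ?c"
    unfolding induced_img[OF c] using x by simp_all
  from TM.local_flow[OF X c' in_img(1)] obtain T z where T: "T > 0" and z0: "z 0 = (x, y)"
    and img: "\<And>t. t \<in> {0..T} \<Longrightarrow> z t \<in> chart_img ?c"
    and dz: "\<And>t. t \<in> {0..T} \<Longrightarrow> (z has_vector_derivative vf_in ?c X (z t)) (at t within {0..T})"
    and flow: "\<And>t. t \<in> {0..T} \<Longrightarrow> flow_rel (tangent_atlas A) X t (chart_inv ?c (x, y)) (chart_inv ?c (z t))"
    by blast
  from TM.local_flow[OF X c' in_img(2)] obtain T' z' where T': "T' > 0" and z0': "z' 0 = (x, y')"
    and img': "\<And>t. t \<in> {0..T'} \<Longrightarrow> z' t \<in> chart_img ?c"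
    and dz': "\<And>t. t \<in> {0..T'} \<Longrightarrow> (z' has_vector_derivative vf_in ?c X (z' t)) (at t within {0..T'})"
    and flow': "\<And>t. t \<in> {0..T'} \<Longrightarrow> flow_rel (tangent_atlas A) X t (chart_inv ?c (x, y')) (chart_inv ?c (z' t))"
    by blast
  define S where "S = min T T'"
  have S: "S > 0" "{0..S} \<subseteq> {0..T}" "{0..S} \<subseteq> {0..T'}" using T T' by (auto simp: S_def)
  have base: "fst (chart_inv ?c (x, y)) = fst (chart_inv ?c (x, y'))"
    by (simp add: induced_inv[OF c x])
  have fst_eq: "fst w = snd c (fst (chart_inv ?c w))" if "w \<in> chart_img ?c" for w
    using chart_chart_inv[OF that] by (metis fst_conv induced_map)
  have eq: "fst (z t) = fst (z' t)" if "t \<in> {0..S}" for t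
  proof -
    have t: "t \<in> {0..T}" "t \<in> {0..T'}" using that S by blast+
    have "fst (chart_inv ?c (z t)) = fst (chart_inv ?c (z' t))"
      using fib flow[OF t(1)] flow'[OF t(2)] base unfolding fiber_preserving_def by blast
    then show ?thesis
      by (simp only: fst_eq[OF img[OF t(1)]] fst_eq[OF img'[OF t(2)]])
  qed
  have 0: "0 \<in> {0..S}" "0 \<in> {0..T}" "0 \<in> {0..T'}" using S T T' by auto
  have d: "((\<lambda>t. fst (z t)) has_vector_derivative fst (vf_in ?c X (x, y))) (at 0 within {0..S})"
    using bounded_linear.has_vector_derivative[OF bounded_linear_fst
        has_vector_derivative_within_subset[OF dz[OF 0(2)] S(2)]] z0 by simp
  have "((\<lambda>t. fst (z' t)) has_vector_derivative fst (vf_in ?c X (x, y'))) (at 0 within {0..S})"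
    using bounded_linear.has_vector_derivative[OF bounded_linear_fst
        has_vector_derivative_within_subset[OF dz'[OF 0(3)] S(3)]] z0' by simp
  then have d': "((\<lambda>t. fst (z t)) has_vector_derivative fst (vf_in ?c X (x, y'))) (at 0 within {0..S})"
    using has_vector_derivative_transform[OF 0(1), of "\<lambda>t. fst (z t)" "\<lambda>t. fst (z' t)"] eq by simp
  \<comment> \<open>Since S is positive, 0 is a limit point of \<open>{0..S}\<close>, and one-sided
    derivatives there are unique.\<close>
  show ?thesis
    by (rule vector_derivative_unique_within[OF _ d d']) (use S in \<open>simp add: trivial_limit_within islimpt_Icc\<close>)
qed

end

section \<open>The conformal factor\<close>

context riemannian
begin

text \<open>Translates the conformal equation on the tangent bundle into the hypotheses of
  \<open>conformal_factor_derivative_zero\<close>, whose b and c are l and m here.\<close>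

lemma conformal_factor_locally_constant:
  assumes conf: "conformal_with (tangent_atlas A) (lift_metric A g k l m) X \<Omega>"
    and X: "vector_field (tangent_atlas A) X" and fib: "fiber_preserving A X" and m: "m \<noteq> 0"
    and f: "\<And>q. q \<in> tangent_bundle A \<Longrightarrow> \<Omega> q = f (fst q)"
    and c: "c \<in> A" and x: "x \<in> chart_img c"
  shows "((f \<circ> chart_inv c) has_derivative (\<lambda>_. 0)) (at x)"
proof -
  interpret local_metric "chart_img c" "G c" by (rule local_metric[OF c])
  let ?c = "induced_chart A c"
  have c': "?c \<in> tangent_atlas A" using c by (simp add: tangent_atlas_def)
  define Y where "Y = vf_in ?c X"
  \<comment> \<open>Any fiber coordinate gives the same value, by
    \<open>fiber_preserving_horizontal\<close>; 0 is a convenient choice.\<close>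
  define Xc where "Xc x = fst (Y (x, 0))" for x
  define V where "V z = snd (Y z)" for z
  define \<omega> where "\<omega> = f \<circ> chart_inv c"
  let ?T = "tensor_in (tangent_atlas A) ?c (lift_metric A g k l m)"
  have O: "open (chart_img c \<times> (UNIV :: (real^'n) set))" by (simp add: open_Times open_U)
  have Y_smooth: "smooth_on (chart_img c \<times> UNIV) Y"
    using X c' unfolding vector_field_def Y_def induced_img[OF c, symmetric] by blast
  have Y_diff: "Y differentiable (at (x, y))" if "x \<in> chart_img c" for x y
    using smooth_on_differentiable[OF Y_smooth] that by blast
  have Y: "Y (x, y) = (Xc x, V (x, y))" if "x \<in> chart_img c" for x y
    using fiber_preserving_horizontal[OF X fib c that, of y 0] by (simp add: Y_def Xc_def V_def prod_eq_iff)
  have Xc_diff: "Xc differentiable (at x)" if "x \<in> chart_img c" for x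
    using has_derivative_fst[OF D_partial_left[OF Y_diff[OF that]]] unfolding Xc_def by (rule differentiableI)
  have V_diff: "V differentiable (at (x, y))" if "x \<in> chart_img c" for x y
    using has_derivative_snd[OF D_works[OF Y_diff[OF that]]] unfolding V_def by (rule differentiableI)
  have DY: "D Y (x, y) (u, w) = (D Xc x u, D V (x, y) (u, w))" if x: "x \<in> chart_img c" for x y u w
  proof -
    have "((\<lambda>z. (Xc (fst z), V z)) has_derivative (\<lambda>z. (D Xc x (fst z), D V (x, y) z))) (at (x, y))"
      using D_fst[of Xc "(x, y)"] Xc_diff[OF x] by (intro has_derivative_Pair D_works V_diff x) simp
    then have "(Y has_derivative (\<lambda>z. (D Xc x (fst z), D V (x, y) z))) (at (x, y))"
      by (rule has_derivative_transform_within_open[OF _ O]) (use x in \<open>auto simp: Y\<close>)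
    then show ?thesis by (simp add: D_eqI)
  qed
  have \<omega>: "\<omega> x = \<Omega> (chart_inv ?c (x, y))" if "x \<in> chart_img c" for x y
  proof -
    have "chart_inv ?c (x, y) \<in> chart_dom ?c"
      using that by (intro chart_inv_in) (simp add: induced_img[OF c])
    then have "chart_inv ?c (x, y) \<in> tangent_bundle A"
      by (simp add: induced_dom)
    then show ?thesis by (simp add: f \<omega>_def induced_inv[OF c that])
  qed
  \<comment> \<open>The function f comes without any regularity; it inherits differentiability from
    \<Omega> along the zero section.\<close>
  have \<omega>_diff: "\<omega> differentiable (at x)" if x: "x \<in> chart_img c" for x
  proof -
    have "smooth_on (chart_img ?c) (\<Omega> \<circ> chart_inv ?c)"
      using conf c' by (simp add: conformal_with_def smooth_function_def)
    then have "\<Omega> \<circ> chart_inv ?c differentiable (at (x, 0))"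
      using x by (intro smooth_on_differentiable[of "chart_img ?c"]) (simp_all add: induced_img[OF c])
    from has_derivative_transform_within_open[OF D_partial_left[OF this] open_U x, of \<omega>]
    show ?thesis by (intro differentiableI) (simp add: \<omega>[of _ 0])
  qed
  have lie: "D (\<lambda>z. ?T z e e') (x, y) (Y (x, y)) + ?T (x, y) (D Y (x, y) e) e' + ?T (x, y) e (D Y (x, y) e')
      = 2 * \<omega> x * ?T (x, y) e e'" if x: "x \<in> chart_img c" for x y e e'
  proof -
    have img: "(x, y) \<in> chart_img ?c" using x by (simp add: induced_img[OF c])
    define q where "q = chart_inv ?c (x, y)"
    have q: "q \<in> chart_dom ?c" "snd ?c q = (x, y)"
      using chart_inv_in[OF img] chart_chart_inv[OF img] by (simp_all add: q_def)
    let ?t = "tangent_of (tangent_atlas A) ?c q"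
    have "lie_derivative (tangent_atlas A) ?c X (lift_metric A g k l m) q (?t e) (?t e')
        = 2 * \<Omega> q * lift_metric A g k l m q (?t e) (?t e')"
      using conf c' q(1) TM.tangent_of_in_tangent_space[OF c' q(1)] unfolding conformal_with_def by blast
    then show ?thesis
      using \<omega>[OF x, of y] unfolding lie_derivative_def Let_def TM.tangent_of_same[OF c' q(1)] q(2)
      by (simp add: Y_def tensor_in_def q_def)
  qed
  \<comment> \<open>The second argument stays vertical: \<open>D Y\<close> maps (0, v) to a vertical
    vector because \<open>Xc\<close> depends on the base only. Hence this formula covers all three
    terms of the Lie derivative.\<close>
  have T: "?T (x, y) (u, w) (0, v) = l * G c x u v + m * (G c x w v + H x y u v)"
    if "x \<in> chart_img c" for x y u w v
    by (rule tensor_in_lift_metric_vertical[OF c that])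
  have DT: "D (\<lambda>z. ?T z (u, w) (0, v)) (x, y) (p, p') =
      l * D (\<lambda>z. G c z u v) x p + m * (D (\<lambda>z. G c z w v) x p + (D (\<lambda>z. H z y u v) x p + H x p' u v))"
    if x: "x \<in> chart_img c" for x y u w v p p'
  proof -
    have dH: "((\<lambda>z. H (fst z) e u v) has_derivative (\<lambda>w. D (\<lambda>z. H z e u v) x (fst w))) (at (x, y))" for e
      using D_fst[of "\<lambda>z. H z e u v" "(x, y)"] H_differentiable[OF x] by simp
    have dG: "((\<lambda>z. G c (fst z) u v) has_derivative (\<lambda>w. D (\<lambda>z. G c z u v) x (fst w))) (at (x, y))" for u v
      using D_fst[of "\<lambda>z. G c z u v" "(x, y)"] G_differentiable[OF x] by simp
    have "((\<lambda>z. H (fst z) (snd z) u v) has_derivative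
        (\<lambda>w. D (\<lambda>z. H (fst z) (snd (x, y)) u v) (x, y) w + H (fst (x, y)) (snd w) u v)) (at (x, y))"
      using x
      by (intro has_derivative_linear_family[where B="\<lambda>z e. H (fst z) e u v", OF O _ _ differentiableI[OF dH]]
          has_derivative_snd has_derivative_ident linear_H) auto
    then have "((\<lambda>z. H (fst z) (snd z) u v) has_derivative
        (\<lambda>w. D (\<lambda>z. H z y u v) x (fst w) + H x (snd w) u v)) (at (x, y))"
      by (simp add: D_eqI[OF dH])
    then have "((\<lambda>z. l * G c (fst z) u v + m * (G c (fst z) w v + H (fst z) (snd z) u v)) has_derivative
      (\<lambda>z. l * D (\<lambda>z. G c z u v) x (fst z) + m * (D (\<lambda>z. G c z w v) x (fst z)
        + (D (\<lambda>z. H z y u v) x (fst z) + H x (snd z) u v)))) (at (x, y))"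
      by (intro has_derivative_add has_derivative_mult_right dG)
    then have "((\<lambda>z. ?T z (u, w) (0, v)) has_derivative
      (\<lambda>z. l * D (\<lambda>z. G c z u v) x (fst z) + m * (D (\<lambda>z. G c z w v) x (fst z)
        + (D (\<lambda>z. H z y u v) x (fst z) + H x (snd z) u v)))) (at (x, y))"
      by (rule has_derivative_transform_within_open[OF _ O]) (use x in \<open>auto simp: T\<close>)
    then show ?thesis by (simp add: D_eqI)
  qed
  \<comment> \<open>These vanishing values specialize the formulas to a first argument (0,
    u).\<close>
  have D0: "D (\<lambda>z. G c z 0 v) x p = 0" "D (\<lambda>z. H z y 0 v) x p = 0" "G c x 0 v = 0" "H x y 0 v = 0"
    "D Xc x 0 = 0"
    if x: "x \<in> chart_img c" for x v p y
    using linear_0[OF linear_DG(1)[OF x]] linear_0[OF linear_G(2)] linear_0[OF linear_H(2)] x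
      linear_0[OF linear_D[OF Xc_diff[OF x]]]
      D_cong[OF open_U x, of "\<lambda>z. H z y 0 v" "\<lambda>z. 0"]
    by (simp_all add: frechet_derivative_const)
  have "D \<omega> x u = 0" for u
  proof (rule conformal_factor_derivative_zero[OF x m Xc_diff V_diff \<omega>_diff, where b=l])
    fix x y u v assume x: "x \<in> chart_img c"
    have "m * (D (\<lambda>z. G c z u v) x (Xc x) + G c x (D V (x, y) (0, u)) v + G c x u (D V (x, y) (0, v)))
        = m * (2 * \<omega> x * G c x u v)"
      using lie[OF x, of "(0, u)" "(0, v)" y]
      by (simp add: Y[OF x] DY[OF x] T[OF x] DT[OF x] D0[OF x] algebra_simps)
    then show "D (\<lambda>z. G c z u v) x (Xc x) + G c x (D V (x, y) (0, u)) v + G c x u (D V (x, y) (0, v))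
        = 2 * \<omega> x * G c x u v"
      using m by simp
    \<comment> \<open>Here (u, 0) is a coordinate vector, not a horizontal one, which accounts for
      the terms with H.\<close>
    show "l * D (\<lambda>z. G c z u v) x (Xc x) + m * (D (\<lambda>z. H z y u v) x (Xc x) + H x (V (x, y)) u v)
      + (l * G c x (D Xc x u) v + m * (G c x (D V (x, y) (u, 0)) v + H x y (D Xc x u) v))
      + (l * G c x u (D V (x, y) (0, v)) + m * H x y u (D V (x, y) (0, v)))
      = 2 * \<omega> x * (l * G c x u v + m * H x y u v)"
      using lie[OF x, of "(u, 0)" "(0, v)" y]
      by (simp add: Y[OF x] DY[OF x] T[OF x] DT[OF x] D0[OF x])
  qed
  then have "D \<omega> x = (\<lambda>_. 0)" by (rule ext)
  then show ?thesis
    using D_works[OF \<omega>_diff[OF x]] by (simp add: \<omega>_def)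
qed

end

text \<open>Local constancy makes every preimage under f open. Applied to \<open>{f p}\<close> and
  its complement, this makes the level set of p clopen and nonempty.\<close>

lemma (in manifold) constant_if_locally_constant:
  fixes f :: "'m \<Rightarrow> real"
  assumes conn: "connected_space M"
    and f: "\<And>c x. c \<in> A \<Longrightarrow> x \<in> chart_img c \<Longrightarrow> ((f \<circ> chart_inv c) has_derivative (\<lambda>_. 0)) (at x)"
    and p: "p \<in> topspace M" "q \<in> topspace M"
  shows "f p = f q"
proof -
  have openin: "openin M {p \<in> topspace M. f p \<in> K}" for K
  proof (subst openin_subopen, intro ballI)
    fix p assume p: "p \<in> {p \<in> topspace M. f p \<in> K}"
    then have "p \<in> carrier_of A"
      using smooth_manifold by (simp add: smooth_manifold_def)
    then obtain c where c: "c \<in> A" "p \<in> chart_dom c"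
      unfolding carrier_of_def by blast
    have dom: "openin M (chart_dom c)"
      and hom: "homeomorphic_map (subtopology M (chart_dom c)) (top_of_set (chart_img c)) (snd c)"
      using smooth_manifold c(1) by (auto simp: smooth_manifold_def)
    \<comment> \<open>A chart image may be disconnected, so constancy is derived on a ball, which is
      convex.\<close>
    obtain r where r: "r > 0" "ball (snd c p) r \<subseteq> chart_img c"
      using open_chart_img[OF c(1)] c(2) by (meson imageI openE)
    have "((f \<circ> chart_inv c) has_derivative (\<lambda>_. 0)) (at x within ball (snd c p) r)"
      if "x \<in> ball (snd c p) r" for x
      by (rule has_derivative_at_withinI[OF f[OF c(1) subsetD[OF r(2) that]]])
    from has_derivative_zero_constant[OF convex_ball this]
    obtain k where k: "\<And>x. x \<in> ball (snd c p) r \<Longrightarrow> (f \<circ> chart_inv c) x = k" by blast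
    let ?N = "{q \<in> chart_dom c. snd c q \<in> ball (snd c p) r}"
    have "openin (top_of_set (chart_img c)) (ball (snd c p) r)"
      using r(2) by (intro open_subset open_ball)
    from openin_continuous_map_preimage[OF homeomorphic_imp_continuous_map[OF hom] this]
    have "openin (subtopology M (chart_dom c)) ?N"
      using openin_subset[OF dom] by (simp add: Int_absorb1)
    then have "openin M ?N" using dom openin_trans_full by blast
    moreover have "p \<in> ?N" using c r by simp
    moreover have "f q = k" if "q \<in> ?N" for q
      using k[of "snd c q"] that chart_inv_chart[OF c(1)] by simp
    ultimately show "\<exists>N. openin M N \<and> p \<in> N \<and> N \<subseteq> {p \<in> topspace M. f p \<in> K}"
      using p openin_subset[OF dom] by (intro exI[of _ ?N]) auto
  qed
  let ?S = "{p' \<in> topspace M. f p' \<in> {f p}}"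
  have "topspace M - ?S = {p' \<in> topspace M. f p' \<in> - {f p}}" by auto
  then have "openin M (topspace M - ?S)" using openin[of "- {f p}"] by (simp only:)
  then have "closedin M ?S" unfolding closedin_def by blast
  then have "?S = {} \<or> ?S = topspace M"
    using conn openin unfolding connected_space_clopen_in by blast
  moreover have "p \<in> ?S" using p(1) by simp
  ultimately have "?S = topspace M" by (metis emptyE)
  then have "q \<in> ?S" using p(2) by (simp only:)
  then show ?thesis by simp
qed

theorem theorem2:
  fixes M :: "'m topology"
    and A :: "('m, real^'n) chart set"
    and g :: "('m, real^'n) tensor2"
    and X :: "'m \<times> ('m, real^'n) tvec \<Rightarrow>
              ('m \<times> ('m, real^'n) tvec, (real^'n) \<times> (real^'n)) tvec"
    and a b c :: real
  assumes "smooth_manifold M A"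
    and "connected_space M"
    and "riemannian_metric A g"
    and "a > 0" and "b > 0" and "c > 0"
    and "a * c - b^2 \<noteq> 0"
    and "vector_field (tangent_atlas A) X"
    and "fiber_preserving A X"
    and "inessential_conformal A (lift_metric A g a b c) X"
  shows "homothetic (tangent_atlas A) (lift_metric A g a b c) X"
proof -
  interpret riemannian M A g
    by standard (rule assms)+
  from assms(10) obtain \<Omega> f
    where conf: "conformal_with (tangent_atlas A) (lift_metric A g a b c) X \<Omega>"
      and f: "\<And>q. q \<in> tangent_bundle A \<Longrightarrow> \<Omega> q = f (fst q)"
    unfolding inessential_conformal_def by blast
  have "c \<noteq> 0" using \<open>c > 0\<close> by simp
  have const: "f p = f q" if "p \<in> topspace M" "q \<in> topspace M" for p q
    using conformal_factor_locally_constant[OF conf assms(8,9) \<open>c \<noteq> 0\<close> f]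
      constant_if_locally_constant[OF assms(2) _ that] by blast
  have base: "fst q \<in> topspace M" if "q \<in> tangent_bundle A" for q
    using that assms(1) by (auto simp: tangent_bundle_def smooth_manifold_def)
  have "\<exists>k. \<forall>q\<in>tangent_bundle A. \<Omega> q = k"
    using f const base by metis
  \<comment> \<open>\<open>homothetic\<close> asks for some conformal factor that is constant on the
    bundle; the given \<Omega> is one.\<close>
  then show ?thesis
    using conf unfolding homothetic_def carrier_tangent_atlas by blast
qed

end
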